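(* Assume each $f_i$ is convex and $L$-smooth, and $g$ is convex. Let $c_f=200$ and run the algorithm ODAPG (described in the context) with $\gamma_t=\frac{t+4}{2Lc_f}$, $\tau_t=\frac{1}{Lc_f\gamma_t}=\frac{2}{t+4}$ and $K=\frac{15}{\sqrt{1-\lambda_2(W)}}$. Then, to find an $\epsilon$-suboptimal solution (that is, to have $F(\overline{y}_T)-F(x^* )\le\epsilon$, where $x^*$ is a minimizer of $F$), the computation complexity $T$ and the communication complexity $C$ of the algorithm for each agent are $$T=\mathcal{O}\left(\frac{1}{\sqrt{\epsilon}}\right)\quad\text{and}\quad C=\mathcal{O}\left(\frac{1}{\sqrt{\epsilon(1-\lambda_2(W))}}\right).$$
   Context: Problem: $f_1,\dots,f_m:\mathbb{R}^d\to\mathbb{R}$ and $g:\mathbb{R}^d\to\mathbb{R}$ (possibly non-differentiable); $f(x)=\frac1m\sum_{i=1}^m f_i(x)$, $F(x)=f(x)+g(x)$. Each agent $i\in\{1,\dots,m\}$ of a connected undirected static network holds $f_i$. "$f_i$ convex and $L$-smooth" means, for all $x,y\in\mathbb{R}^d$: $f_i(y)\ge f_i(x)+\langle\nabla f_i(x),y-x\rangle$ and $f_i(y)\le f_i(x)+\langle\nabla f_i(x),y-x\rangle+\frac L2\|x-y\|^2$. Weight matrix: $W\in\mathbb{R}^{m\times m}$ is symmetric, $W_{i,j}\ne0$ iff agents $i,j$ are connected or $i=j$, $\mathbf{0}\preceq W\preceq I$, $W\mathbf{1}=\mathbf{1}$, $\mathrm{null}(I-W)=\mathrm{span}(\mathbf{1})$;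 $\lambda_2(W)$ is its second largest eigenvalue. Notation: vectors of $\mathbb{R}^d$ are identified with row vectors. Bold letters denote $m\times d$ matrices with $i$-th row $\mathbf{x}^{(i)}$, etc.; $\overline{y}=\frac1m\mathbf{1}^\top\mathbf{y}$ is the average of the rows, $\mathbf{1}\in\mathbb{R}^m$ the all-ones vector. $\|\cdot\|$ is the Frobenius (Euclidean) norm. $\nabla\widetilde f(\mathbf{x})$ is the $m\times d$ matrix with $i$-th row $\nabla f_i(\mathbf{x}^{(i)})$. $\mathrm{prox}_{\gamma g}(\mathbf{x})$ is the $m\times d$ matrix with $i$-th row $\mathrm{argmin}_{w\in\mathbb{R}^d}\{\gamma g(w)+\frac12\|w-\mathbf{x}^{(i)}\|^2\}$. $\mathrm{FastMix}(\mathbf{x},K)$: set $\mathbf{x}^0=\mathbf{x}^1=\mathbf{x}$, $\eta_w=1/(1+\sqrt{1-\lambda_2^2(W)})$, and for $k=1,\dots,K$ let $\mathbf{x}^{k+1}=(1+\eta_w)W\mathbf{x}^k-\eta_w\mathbf{x}^{k-1}$; the output is $\mathbf{x}^K$. ($K$ is an iteration count, understood as a positive integer.) Algorithm ODAPG: given $x_1\in\mathbb{R}^d$, set $\mathbf{z}_1=\mathbf{y}_1=\mathbf{x}_1=\mathbf{1}x_1$ and $\mathbf{s}_1=\nabla\widetilde f(\mathbf{x}_1)$. For $t=1,2,\dots$: $\mathbf{x}_{t+1}=\tau_t\mathbf{z}_t+(1-\tau_t)\mathbf{y}_t$; $\mathbf{s}_{t+1}=\mathrm{FastMix}(\mathbf{s}_t+\nabla\widetilde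 f(\mathbf{x}_{t+1})-\nabla\widetilde f(\mathbf{x}_t),K)$; $\mathbf{z}_{t+1}=\mathrm{FastMix}(\mathrm{prox}_{\gamma_t g}(\mathbf{z}_t-\gamma_t\mathbf{s}_{t+1}),K)$; $\mathbf{y}_{t+1}=\mathrm{FastMix}(\tau_t\mathbf{z}_{t+1}+(1-\tau_t)\mathbf{y}_t,K)$. Complexities: the computation complexity is the number of local gradient evaluations per agent, counted as one per iteration, hence equal to the number $T$ of iterations. The communication complexity is the number of rounds of local communication, counted as $K$ per FastMix call with three FastMix calls per iteration, i.e. $C=3TK$. The $\mathcal{O}(\cdot)$ is as $\epsilon\to0$, with constants that may depend on $m$, $L$, the objective and the initial point, but not on $\epsilon$ or $W$. *)

theory Defs
  imports "HOL-Analysis.Analysis" "HOL-Library.Landau_Symbols" "HOL-Library.Multiset"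
begin

definition gradient :: "('a::real_inner \<Rightarrow> real) \<Rightarrow> 'a \<Rightarrow> 'a" where
  "gradient f x = (THE D. GDERIV f x :> D)"

definition convex_smooth :: "real \<Rightarrow> ('a::real_inner \<Rightarrow> real) \<Rightarrow> bool" where
  "convex_smooth L f \<longleftrightarrow>
     (\<forall>x. f differentiable (at x)) \<and>
     (\<forall>x y. f y \<ge> f x + gradient f x \<bullet> (y - x)) \<and>
     (\<forall>x y. f y \<le> f x + gradient f x \<bullet> (y - x) + L / 2 * (norm (x - y))\<^sup>2)"

definition prox :: "real \<Rightarrow> ('a::real_normed_vector \<Rightarrow> real) \<Rightarrow> 'a \<Rightarrow> 'a" where
  "prox \<gamma> g v = (ARG_MIN (\<lambda>w. \<gamma> * g w + 1 / 2 * (norm (w - v))\<^sup>2) w. True)"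

definition objective :: "('m::finite \<Rightarrow> 'a \<Rightarrow> real) \<Rightarrow> ('a \<Rightarrow> real) \<Rightarrow> 'a \<Rightarrow> real" where
  "objective f g x = (1 / real CARD('m)) * (\<Sum>i\<in>UNIV. f i x) + g x"

definition eigenspace :: "real^'n^'n \<Rightarrow> real \<Rightarrow> (real^'n) set" where
  "eigenspace A l = {v. A *v v = l *s v}"

text \<open>
  The eigenvalues of a symmetric matrix with multiplicity; for symmetric matrices the geometric
  multiplicity used here is also the algebraic one.
\<close>
definition eigenvalues :: "real^'n^'n \<Rightarrow> real multiset" where
  "eigenvalues A =
     (\<Sum>l \<in> {l. eigenspace A l \<noteq> {0}}. replicate_mset (dim (eigenspace A l)) l)"

definition lambda2 :: "real^'n^'n \<Rightarrow> real" where
  "lambda2 A = Max_mset (eigenvalues A - {#Max_mset (eigenvalues A)#})"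

definition loewner_le :: "real^'n^'n \<Rightarrow> real^'n^'n \<Rightarrow> bool" where
  "loewner_le A B \<longleftrightarrow> (\<forall>v. v \<bullet> ((B - A) *v v) \<ge> 0)"

definition connected_network :: "('m \<Rightarrow> 'm \<Rightarrow> bool) \<Rightarrow> bool" where
  "connected_network E \<longleftrightarrow> symp E \<and> irreflp E \<and> (\<forall>i j. E\<^sup>*\<^sup>* i j)"

definition weight_matrix :: "('m \<Rightarrow> 'm \<Rightarrow> bool) \<Rightarrow> real^'m^'m \<Rightarrow> bool" where
  "weight_matrix E W \<longleftrightarrow>
     transpose W = W \<and>
     (\<forall>i j. W $ i $ j \<noteq> 0 \<longleftrightarrow> E i j \<or> i = j) \<and>
     loewner_le 0 W \<and> loewner_le W (mat 1) \<and>
     W *v 1 = 1 \<and>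
     {v. (mat 1 - W) *v v = 0} = span {1}"

definition admissible_weights :: "(real^'m^'m) set" where
  "admissible_weights = {W. \<exists>E. connected_network E \<and> weight_matrix E W}"

text \<open>
  An \<open>m \<times> d\<close> matrix is an element of \<^typ>\<open>real^'d^'m\<close>, whose \<open>i\<close>-th row is its
  \<open>i\<close>-th component.
\<close>

definition row_average :: "real^'d^'m \<Rightarrow> real^'d" where
  "row_average X = (1 / real CARD('m)) *\<^sub>R (\<Sum>i\<in>UNIV. X $ i)"

definition local_gradients :: "('m \<Rightarrow> real^'d \<Rightarrow> real) \<Rightarrow> real^'d^'m \<Rightarrow> real^'d^'m" where
  "local_gradients f X = (\<chi> i. gradient (f i) (X $ i))"

definition row_prox :: "real \<Rightarrow> (real^'d \<Rightarrow> real) \<Rightarrow> real^'d^'m \<Rightarrow> real^'d^'m" where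
  "row_prox \<gamma> g X = (\<chi> i. prox \<gamma> g (X $ i))"

fun fastmix_iter :: "real^'m^'m \<Rightarrow> real^'d^'m \<Rightarrow> nat \<Rightarrow> real^'d^'m" where
  "fastmix_iter W X 0 = X"
| "fastmix_iter W X (Suc 0) = X"
| "fastmix_iter W X (Suc (Suc k)) =
     (let \<eta> = 1 / (1 + sqrt (1 - (lambda2 W)\<^sup>2))
      in (1 + \<eta>) *\<^sub>R (W ** fastmix_iter W X (Suc k)) - \<eta> *\<^sub>R fastmix_iter W X k)"

definition FastMix :: "real^'m^'m \<Rightarrow> nat \<Rightarrow> real^'d^'m \<Rightarrow> real^'d^'m" where
  "FastMix W K X = fastmix_iter W X K"

record ('d, 'm) odapg_state =
  st_x :: "real^'d^'m"
  st_y :: "real^'d^'m"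
  st_z :: "real^'d^'m"
  st_s :: "real^'d^'m"

definition odapg_init ::
  "('m \<Rightarrow> real^'d \<Rightarrow> real) \<Rightarrow> real^'d \<Rightarrow> ('d::finite, 'm::finite) odapg_state" where
  "odapg_init f x1 =
     (let X = (\<chi> i. x1) in \<lparr>st_x = X, st_y = X, st_z = X, st_s = local_gradients f X\<rparr>)"

definition odapg_step ::
  "('m \<Rightarrow> real^'d \<Rightarrow> real) \<Rightarrow> (real^'d \<Rightarrow> real) \<Rightarrow> real^'m^'m \<Rightarrow> nat \<Rightarrow> real \<Rightarrow> real
     \<Rightarrow> ('d::finite, 'm::finite) odapg_state \<Rightarrow> ('d, 'm) odapg_state" where
  "odapg_step f g W K \<gamma> \<tau> S =
     (let x = \<tau> *\<^sub>R st_z S + (1 - \<tau>) *\<^sub>R st_y S;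
          s = FastMix W K (st_s S + local_gradients f x - local_gradients f (st_x S));
          z = FastMix W K (row_prox \<gamma> g (st_z S - \<gamma> *\<^sub>R s));
          y = FastMix W K (\<tau> *\<^sub>R z + (1 - \<tau>) *\<^sub>R st_y S)
      in \<lparr>st_x = x, st_y = y, st_z = z, st_s = s\<rparr>)"

text \<open>The sequences start at index 1; index 0 is a dummy that repeats the initial state.\<close>
fun odapg ::
  "('m \<Rightarrow> real^'d \<Rightarrow> real) \<Rightarrow> (real^'d \<Rightarrow> real) \<Rightarrow> real^'m^'m \<Rightarrow> nat
     \<Rightarrow> (nat \<Rightarrow> real) \<Rightarrow> (nat \<Rightarrow> real) \<Rightarrow> real^'d \<Rightarrow> nat \<Rightarrow> ('d::finite, 'm::finite) odapg_state" where
  "odapg f g W K \<gamma> \<tau> x1 0 = odapg_init f x1"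
| "odapg f g W K \<gamma> \<tau> x1 (Suc 0) = odapg_init f x1"
| "odapg f g W K \<gamma> \<tau> x1 (Suc (Suc n)) =
     odapg_step f g W K (\<gamma> (Suc n)) (\<tau> (Suc n)) (odapg f g W K \<gamma> \<tau> x1 (Suc n))"

definition eps_suboptimal :: "('a \<Rightarrow> real) \<Rightarrow> 'a \<Rightarrow> real \<Rightarrow> 'a \<Rightarrow> bool" where
  "eps_suboptimal F xstar \<epsilon> x \<longleftrightarrow> F x - F xstar \<le> \<epsilon>"

text \<open>
  The first \<open>T \<ge> 1\<close> at which the sequence is \<open>\<epsilon>\<close>-suboptimal.  The value is arbitrary if there
  is no such \<open>T\<close>, so bounds on it have to come with a proof that one exists.
\<close>
definition computation_complexity :: "('a \<Rightarrow> real) \<Rightarrow> 'a \<Rightarrow> (nat \<Rightarrow> 'a) \<Rightarrow> real \<Rightarrow> nat" where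
  "computation_complexity F xstar ybar \<epsilon> =
     (LEAST T. 1 \<le> T \<and> eps_suboptimal F xstar \<epsilon> (ybar T))"

text \<open>Three \<^const>\<open>FastMix\<close> calls per iteration, each with \<open>K\<close> rounds of communication.\<close>
definition communication_complexity ::
  "('a \<Rightarrow> real) \<Rightarrow> 'a \<Rightarrow> (nat \<Rightarrow> 'a) \<Rightarrow> nat \<Rightarrow> real \<Rightarrow> nat" where
  "communication_complexity F xstar ybar K \<epsilon> = 3 * computation_complexity F xstar ybar \<epsilon> * K"

end

theory Submission
  imports Defs
begin

text \<open>
  The averages of the rows follow an accelerated proximal gradient iteration whose gradients are
  inexact because the agents disagree; the errors are controlled by how far the rows are from
  their average.  Three observations make the rate \<open>1 / T\<^sup>2\<close> hold with a constant that does not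
  depend on \<open>W\<close>.

  First, \<open>FastMix\<close> preserves the average of the rows, and with
  \<open>K = \<lceil>15 / sqrt (1 - \<lambda>\<^sub>2)\<rceil>\<close> it shrinks the deviation from it by at least a factor 100, for every
  weight matrix (\<open>FastMix_contracts_deviation\<close>).  In an orthonormal eigenbasis of \<open>W\<close> each component obeys
  a scalar recurrence with momentum; a quadratic form in two consecutive terms decays exactly
  geometrically (\<open>momentum_poly_energy\<close>), which bounds its damping factor by \<open>sqrt (3 * \<eta> ^ K)\<close>, and
  \<open>\<eta> ^ K \<le> 1 / 2 ^ 15\<close>.

  Second, one step of the averaged iteration (\<open>accelerated_step\<close>) is the usual estimate for
  accelerated methods, plus the squared deviations of the point where the gradients are taken and
  of the argument of the proximal map.  On its good side it keeps two terms that are often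
  dropped: the squared move of the average of \<open>z\<close>, which survives because the step size is 200 times
  smaller than smoothness demands, and the squared gap between the gradients at the average of \<open>y\<close>
  and those at the rows of \<open>x\<close>, which comes from co-coercivity.

  Third, the drift of the tracked gradients between two iterations is bounded by precisely these
  two terms and by earlier deviations: the gap is the change of the gradients from \<open>y\<close> to the next
  \<open>x\<close>, and the change from the current \<open>x\<close> to \<open>y\<close> is governed by the move of \<open>z\<close>.  So the sum of the
  potential of the accelerated iteration and four squared, suitably scaled consensus errors never
  increases (\<open>lyapunov_decreasing\<close>).  Its initial value involves no \<open>W\<close>, which gives a bound
  \<open>C / T\<^sup>2\<close> on the suboptimality (\<open>suboptimality_bound\<close>) and hence both complexities.
\<close>

section \<open>Orthonormal eigenbases of symmetric matrices\<close>

lemma quadratic_nonneg_linear_coeff_zero: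
  fixes a b :: real
  assumes "\<And>t. 0 \<le> 2 * t * a + t\<^sup>2 * b"
  shows "a = 0"
proof -
  define c where "c = \<bar>b\<bar> + 1"
  have c: "c > 0" "b < c" unfolding c_def by auto
  have "0 \<le> 2 * (- a / c) * a + (- a / c)\<^sup>2 * b"
    by (rule assms)
  also have "\<dots> = a\<^sup>2 / c * (b / c - 2)"
    using c by (simp add: field_simps power2_eq_square)
  finally have "0 \<le> a\<^sup>2 / c * (b / c - 2)" .
  moreover have "b / c - 2 < 0"
    using c by (simp add: field_simps)
  ultimately have "a\<^sup>2 / c \<le> 0"
    by (smt (verit) mult_pos_neg)
  then show ?thesis
    using c by (simp add: divide_le_0_iff)
qed

text \<open>
  The quadratic form \<open>y \<mapsto> l * (y \<bullet> y) - y \<bullet> T y\<close>, where \<open>l\<close> is the maximum, is nonnegative on \<open>S\<close>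
  and vanishes at \<open>b\<close>, so its derivative at \<open>b\<close> vanishes in all directions of \<open>S\<close>; one of these is
  the residual \<open>l *\<^sub>R b - T b\<close> itself.
\<close>
lemma rayleigh_maximizer_is_eigenvector:
  fixes T :: "'a::euclidean_space \<Rightarrow> 'a"
  assumes T: "linear T" and adj: "\<And>x y. T x \<bullet> y = x \<bullet> T y"
    and S: "subspace S" and inv: "\<And>x. x \<in> S \<Longrightarrow> T x \<in> S"
    and b: "b \<in> S" "norm b = 1"
    and max: "\<And>y. y \<in> S \<Longrightarrow> norm y = 1 \<Longrightarrow> y \<bullet> T y \<le> b \<bullet> T b"
  shows "T b = (b \<bullet> T b) *\<^sub>R b"
proof -
  define l where "l = b \<bullet> T b"
  have bb: "b \<bullet> b = 1" using b by (simp add: norm_eq_1)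
  have Q: "y \<bullet> T y \<le> l * (y \<bullet> y)" if "y \<in> S" for y
  proof (cases "y = 0")
    case False
    have "(y /\<^sub>R norm y) \<bullet> T (y /\<^sub>R norm y) \<le> l"
      unfolding l_def using max[of "y /\<^sub>R norm y"] False that S by (simp add: subspace_scale)
    then have "(y \<bullet> T y) / (norm y)\<^sup>2 \<le> l"
      by (simp add: linear_scale[OF T] power2_eq_square field_simps)
    then show ?thesis
      using False by (simp add: power2_norm_eq_inner[symmetric] field_simps)
  qed (simp add: linear_0[OF T])
  have orth: "(l *\<^sub>R b - T b) \<bullet> y = 0" if y: "y \<in> S" for y
  proof (rule quadratic_nonneg_linear_coeff_zero)
    fix t :: real
    have "b + t *\<^sub>R y \<in> S"
      using b y S by (simp add: subspace_add subspace_scale)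
    from Q[OF this] show "0 \<le> 2 * t * ((l *\<^sub>R b - T b) \<bullet> y) + t\<^sup>2 * (l * (y \<bullet> y) - y \<bullet> T y)"
      using adj[of y b] bb
      by (simp add: linear_add[OF T] linear_scale[OF T] inner_add inner_diff inner_commute l_def
          power2_eq_square algebra_simps)
  qed
  have "l *\<^sub>R b - T b \<in> S"
    using b inv S by (simp add: subspace_diff subspace_scale)
  from orth[OF this] show ?thesis
    unfolding l_def by simp
qed

text \<open>
  The spectral theorem for self-adjoint maps, relative to an invariant subspace so that it can be
  proved by induction on the dimension: split off an eigenvector that maximises the Rayleigh
  quotient, and pass to its orthogonal complement in \<open>S\<close>, which is again invariant.
\<close>
theorem orthonormal_eigenbasis:
  fixes T :: "'a::euclidean_space \<Rightarrow> 'a"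
  assumes T: "linear T" and adj: "\<And>x y. T x \<bullet> y = x \<bullet> T y"
    and S: "subspace S" and inv: "\<And>x. x \<in> S \<Longrightarrow> T x \<in> S"
  shows "\<exists>B. B \<subseteq> S \<and> finite B \<and> span B = S \<and> pairwise orthogonal B \<and>
           (\<forall>b\<in>B. norm b = 1 \<and> (\<exists>l. T b = l *\<^sub>R b))"
  using S inv
proof (induction "dim S" arbitrary: S rule: less_induct)
  case less
  show ?case
  proof (cases "S = {0}")
    case True
    then show ?thesis by (intro exI[of _ "{}"]) auto
  next
    case False
    then obtain y where y: "y \<in> S" "y \<noteq> 0"
      using subspace_0[OF less.prems(1)] by blast
    have "compact (S \<inter> sphere 0 1)"
      using closed_subspace[OF less.prems(1)] by (simp add: closed_Int_compact)
    moreover have "y /\<^sub>R norm y \<in> S \<inter> sphere 0 1"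
      using y less.prems(1) by (simp add: subspace_scale)
    moreover have "continuous_on (S \<inter> sphere 0 1) (\<lambda>x. x \<bullet> T x)"
      using T by (intro continuous_intros linear_continuous_on linear_conv_bounded_linear[THEN iffD1])
    ultimately have "\<exists>b \<in> S \<inter> sphere 0 1. \<forall>y \<in> S \<inter> sphere 0 1. y \<bullet> T y \<le> b \<bullet> T b"
      by (intro continuous_attains_sup) blast+
    then obtain b where b: "b \<in> S" "norm b = 1"
      and max: "\<And>y. y \<in> S \<Longrightarrow> norm y = 1 \<Longrightarrow> y \<bullet> T y \<le> b \<bullet> T b"
      by auto
    have eig: "T b = (b \<bullet> T b) *\<^sub>R b"
      using less.prems b max T adj by (intro rayleigh_maximizer_is_eigenvector) auto
    have bb: "b \<bullet> b = 1" using b by (simp add: norm_eq_1)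
    define S' where "S' = {x \<in> S. b \<bullet> x = 0}"
    have S': "subspace S'"
      using less.prems(1) unfolding S'_def subspace_def by (auto simp: inner_add)
    have inv': "T x \<in> S'" if "x \<in> S'" for x
    proof -
      have "b \<bullet> T x = (b \<bullet> T b) * (b \<bullet> x)"
        by (metis adj eig inner_scaleR_left)
      then show ?thesis using that less.prems(2) by (auto simp: S'_def)
    qed
    have "S' \<subset> S"
      using b bb unfolding S'_def by force
    then have "dim S' < dim S"
      using S' less.prems(1) by (metis dim_psubset span_eq_iff)
    from less.hyps[OF this S' inv'] obtain B where B: "B \<subseteq> S'" "finite B" "span B = S'"
      "pairwise orthogonal B" "\<forall>b\<in>B. norm b = 1 \<and> (\<exists>l. T b = l *\<^sub>R b)" by blast
    have "x \<in> span (insert b B)" if "x \<in> S" for x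
    proof -
      have "x - (b \<bullet> x) *\<^sub>R b \<in> span B"
        unfolding B(3) S'_def using that b less.prems(1) bb
        by (simp add: subspace_diff subspace_scale inner_diff)
      then show ?thesis by (auto simp: span_insert)
    qed
    moreover have "insert b B \<subseteq> S" using B(1) b by (auto simp: S'_def)
    ultimately have "span (insert b B) = S"
      using less.prems(1) span_minimal by blast
    moreover have "pairwise orthogonal (insert b B)"
      using B(1,4) by (auto simp: pairwise_insert S'_def orthogonal_def inner_commute)
    ultimately show ?thesis
      using B eig b \<open>insert b B \<subseteq> S\<close> by (intro exI[of _ "insert b B"]) auto
  qed
qed

lemma symmetric_matrix_orthonormal_eigenbasis:
  fixes A :: "real^'n^'n"
  assumes "transpose A = A"
  obtains B where "finite B" "span B = UNIV" "pairwise orthogonal B" "\<And>b. b \<in> B \<Longrightarrow> norm b = 1"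
    "\<And>b. b \<in> B \<Longrightarrow> \<exists>l. A *v b = l *s b"
proof -
  have "(A *v x) \<bullet> y = x \<bullet> (A *v y)" for x y
    by (metis assms dot_lmul_matrix vector_transpose_matrix)
  from orthonormal_eigenbasis[OF matrix_vector_mul_linear this subspace_UNIV] that show ?thesis
    by (auto simp: scalar_mult_eq_scaleR)
qed

lemma parseval:
  fixes x :: "'a::euclidean_space"
  assumes "finite B" "span B = UNIV" "pairwise orthogonal B" "\<And>b. b \<in> B \<Longrightarrow> norm b = 1"
  shows "(norm x)\<^sup>2 = (\<Sum>b\<in>B. (b \<bullet> x)\<^sup>2)"
proof -
  have x: "(\<Sum>b\<in>B. (b \<bullet> x) *\<^sub>R b) = x"
    using orthonormal_basis_expand[of B x] assms by (simp add: inner_commute)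
  have "(norm x)\<^sup>2 = x \<bullet> (\<Sum>b\<in>B. (b \<bullet> x) *\<^sub>R b)"
    by (simp add: x power2_norm_eq_inner)
  also have "\<dots> = (\<Sum>b\<in>B. (b \<bullet> x)\<^sup>2)"
    by (simp add: inner_sum_right power2_eq_square inner_commute)
  finally show ?thesis .
qed

section \<open>The spectrum of a weight matrix\<close>

text \<open>
  The sum that defines \<^const>\<open>eigenvalues\<close> is meaningful only over a finite index set.  Every
  eigenvalue already occurs on the eigenbasis: its eigenvector has a nonzero component along some
  basis vector, and eigenvectors with different eigenvalues are orthogonal.
\<close>
lemma finite_eigenvalues:
  fixes A :: "real^'n^'n"
  assumes "transpose A = A"
  shows "finite {l. eigenspace A l \<noteq> {0}}"
proof -
  obtain B where B: "finite B" "span B = UNIV" "pairwise orthogonal B"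
    "\<And>b. b \<in> B \<Longrightarrow> norm b = 1" "\<And>b. b \<in> B \<Longrightarrow> \<exists>l. A *v b = l *s b"
    using symmetric_matrix_orthonormal_eigenbasis[OF assms] by blast
  have "{l. eigenspace A l \<noteq> {0}} \<subseteq> (\<lambda>b. THE l. A *v b = l *s b) ` B"
  proof
    fix l assume "l \<in> {l. eigenspace A l \<noteq> {0}}"
    then obtain v where v: "v \<noteq> 0" "A *v v = l *s v"
      by (auto simp: eigenspace_def)
    have "\<exists>b\<in>B. b \<bullet> v \<noteq> 0"
      using parseval[OF B(1-4), of v] v(1) by (metis (no_types, lifting) sum.neutral
          norm_eq_zero zero_eq_power2)
    then obtain b where b: "b \<in> B" "b \<bullet> v \<noteq> 0" by blast
    obtain l' where l': "A *v b = l' *s b" using B(5)[OF b(1)] by blast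
    have "(A *v b) \<bullet> v = b \<bullet> (A *v v)"
      by (metis assms dot_lmul_matrix vector_transpose_matrix)
    then have "A *v b = l *s b"
      using b(2) v(2) l' by (simp add: scalar_mult_eq_scaleR)
    moreover have "b \<noteq> 0" using b(2) by auto
    ultimately have "l = (THE l. A *v b = l *s b)"
      by (intro the_equality[symmetric]) (auto simp: scalar_mult_eq_scaleR)
    then show "l \<in> (\<lambda>b. THE l. A *v b = l *s b) ` B" using b(1) by blast
  qed
  then show ?thesis using B(1) finite_surj by blast
qed

lemma count_eigenvalues:
  fixes A :: "real^'n^'n"
  assumes "transpose A = A"
  shows "count (eigenvalues A) l = dim (eigenspace A l)"
proof -
  have "count (eigenvalues A) l =
      (\<Sum>k\<in>{l. eigenspace A l \<noteq> {0}}. if k = l then dim (eigenspace A k) else 0)"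
    unfolding eigenvalues_def count_sum by (intro sum.cong) auto
  also have "\<dots> = (if eigenspace A l \<noteq> {0} then dim (eigenspace A l) else 0)"
    using finite_eigenvalues[OF assms] by (simp add: sum.delta)
  finally show ?thesis by auto
qed

lemma mem_eigenvalues_iff:
  fixes A :: "real^'n^'n"
  assumes "transpose A = A"
  shows "l \<in># eigenvalues A \<longleftrightarrow> (\<exists>v. v \<noteq> 0 \<and> A *v v = l *s v)"
proof -
  have "l \<in># eigenvalues A \<longleftrightarrow> \<not> eigenspace A l \<subseteq> {0}"
    unfolding count_greater_zero_iff[symmetric] count_eigenvalues[OF assms]
    by (metis dim_eq_0 neq0_conv)
  then show ?thesis by (auto simp: eigenspace_def)
qed

text \<open>
  All eigenvalues lie in \<open>[0, 1]\<close>, and \<open>1\<close> has multiplicity one because its eigenspace is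
  \<open>span {1}\<close>.  Removing one copy of the maximum therefore leaves exactly the eigenvalues that
  belong to eigenvectors outside \<open>span {1}\<close>; with at least two agents there is one.
\<close>
lemma weight_matrix_spectrum:
  fixes W :: "real^'m^'m"
  assumes W: "weight_matrix E W" and m: "CARD('m) \<ge> 2"
  shows "0 \<le> lambda2 W" "lambda2 W < 1"
    and "\<And>v l. v \<noteq> 0 \<Longrightarrow> W *v v = l *s v \<Longrightarrow> v \<in> span {1} \<or> (0 \<le> l \<and> l \<le> lambda2 W)"
proof -
  have sym: "transpose W = W" and one: "W *v 1 = 1"
    and null: "\<And>v. (mat 1 - W) *v v = 0 \<longleftrightarrow> v \<in> span {1}"
    using W unfolding weight_matrix_def by blast+
  have eig1: "eigenspace W 1 = span {1}"
  proof -
    have "W *v v = 1 *s v \<longleftrightarrow> (mat 1 - W) *v v = 0" for v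
      unfolding matrix_vector_mult_diff_rdistrib matrix_vector_mul_lid by auto
    then show ?thesis unfolding eigenspace_def null by blast
  qed
  have one0: "(1 :: real^'m) \<noteq> 0" by (simp add: vec_eq_iff)
  have range: "0 \<le> l \<and> l \<le> 1" if "v \<noteq> 0" "W *v v = l *s v" for v l
  proof -
    have "0 \<le> v \<bullet> (W *v v)" "0 \<le> v \<bullet> (v - W *v v)"
      using W unfolding weight_matrix_def loewner_le_def
      by (auto simp: matrix_vector_mult_diff_rdistrib)
    moreover have "v \<bullet> v > 0" using that(1) by simp
    ultimately show ?thesis
      unfolding that(2) by (auto simp: scalar_mult_eq_scaleR inner_diff zero_le_mult_iff)
  qed
  have mem1: "1 \<in># eigenvalues W"
    unfolding mem_eigenvalues_iff[OF sym] using one one0 by (intro exI[of _ 1]) simp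
  have "Max_mset (eigenvalues W) = 1"
    using mem1 range by (intro Max_eqI) (auto simp: mem_eigenvalues_iff[OF sym])
  then have l2: "lambda2 W = Max_mset (eigenvalues W - {#1#})"
    unfolding lambda2_def by simp
  have "count (eigenvalues W) 1 = 1"
    unfolding count_eigenvalues[OF sym] eig1 using one0 by (simp add: dim_span)
  then have mem: "l \<in># eigenvalues W - {#1#} \<longleftrightarrow> l \<in># eigenvalues W \<and> l \<noteq> 1" for l
    by (metis (no_types, lifting) One_nat_def count_diff count_single count_greater_zero_iff
        diff_self_eq_0 diff_zero less_numeral_extra(3))
  have nontriv: "l \<in># eigenvalues W - {#1#}" if "v \<noteq> 0" "W *v v = l *s v" "v \<notin> span {1}" for v l
  proof -
    have "v \<in> eigenspace W l" using that(2) by (simp add: eigenspace_def)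
    then have "l \<noteq> 1" using that(3) eig1 by metis
    then show ?thesis unfolding mem mem_eigenvalues_iff[OF sym] using that by blast
  qed
  show le: "v \<in> span {1} \<or> (0 \<le> l \<and> l \<le> lambda2 W)" if "v \<noteq> 0" "W *v v = l *s v" for v l
  proof (cases "v \<in> span {1}")
    case False
    then show ?thesis using range[OF that] nontriv[OF that False] unfolding l2 by simp
  qed blast
  obtain B where B: "finite B" "span B = (UNIV :: (real^'m) set)" "pairwise orthogonal B"
    "\<And>b. b \<in> B \<Longrightarrow> norm b = 1" "\<And>b. b \<in> B \<Longrightarrow> \<exists>l. W *v b = l *s b"
    using symmetric_matrix_orthonormal_eigenbasis[OF sym] by blast
  have "\<not> B \<subseteq> span {1}"
  proof
    assume "B \<subseteq> span {1}"
    then have "span B \<subseteq> span {1}" by (simp add: span_minimal)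
    then have "dim (UNIV :: (real^'m) set) \<le> dim (span {1 :: real^'m})"
      using B(2) by (metis dim_subset)
    also have "\<dots> \<le> 1"
      by (metis dim_span dim_le_card' card.empty card_insert_disjoint empty_iff finite.emptyI
          finite_insert One_nat_def)
    finally show False using m by (simp add: dim_UNIV)
  qed
  then obtain b l where b: "b \<in> B" "b \<notin> span {1}" "W *v b = l *s b" using B(5) by blast
  have "b \<noteq> 0" using B(4)[OF b(1)] by auto
  then have "l \<in># eigenvalues W - {#1#}" "0 \<le> l" "l \<le> lambda2 W"
    using nontriv[of b l] le[of b l] b by auto
  then show "0 \<le> lambda2 W" by simp
  have "lambda2 W \<in># eigenvalues W - {#1#}"
    unfolding l2 using \<open>l \<in># eigenvalues W - {#1#}\<close> by (intro Max_in) auto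
  then show "lambda2 W < 1"
    using range by (force simp: mem mem_eigenvalues_iff[OF sym])
qed

section \<open>The momentum recurrence on one eigenvector\<close>

text \<open>
  \<open>FastMix\<close> multiplies the component along an eigenvector with eigenvalue \<open>l\<close> by this polynomial
  in \<open>l\<close> (see \<open>eigenvector_fastmix\<close> below).
\<close>
fun momentum_poly :: "real \<Rightarrow> real \<Rightarrow> nat \<Rightarrow> real" where
  "momentum_poly \<eta> l 0 = 1"
| "momentum_poly \<eta> l (Suc 0) = 1"
| "momentum_poly \<eta> l (Suc (Suc k)) =
     (1 + \<eta>) * l * momentum_poly \<eta> l (Suc k) - \<eta> * momentum_poly \<eta> l k"

text \<open>
  The companion matrix of the recurrence has determinant \<open>\<eta>\<close>, and the quadratic form that comes
  from its characteristic polynomial is multiplied by this determinant in each step.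
\<close>
lemma momentum_poly_energy:
  "(momentum_poly \<eta> l (Suc k))\<^sup>2 - (1 + \<eta>) * l * momentum_poly \<eta> l (Suc k) * momentum_poly \<eta> l k
     + \<eta> * (momentum_poly \<eta> l k)\<^sup>2 = \<eta> ^ k * ((1 + \<eta>) * (1 - l))"
proof (induction k)
  case (Suc k)
  define p q where "p = momentum_poly \<eta> l (Suc k)" and "q = momentum_poly \<eta> l k"
  have "(momentum_poly \<eta> l (Suc (Suc k)))\<^sup>2
      - (1 + \<eta>) * l * momentum_poly \<eta> l (Suc (Suc k)) * momentum_poly \<eta> l (Suc k)
      + \<eta> * (momentum_poly \<eta> l (Suc k))\<^sup>2 = \<eta> * (p\<^sup>2 - (1 + \<eta>) * l * p * q + \<eta> * q\<^sup>2)"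
    unfolding p_def q_def by (simp add: algebra_simps power2_eq_square)
  then show ?case using Suc.IH unfolding p_def q_def by simp
qed (simp add: algebra_simps)

text \<open>
  Put \<open>\<eta> = 1 / (1 + s)\<close> and divide by \<open>(1 + s)\<^sup>2\<close>: the left-hand side becomes four times the
  initial energy \<open>(1 + \<eta>) * (1 - l)\<close>, the right-hand side three times the negated discriminant
  \<open>4 * \<eta> - (1 + \<eta>)\<^sup>2 * l\<^sup>2\<close> of the recurrence.  The left-hand side minus the right-hand side is
  convex in \<open>l\<close>, so only the end points \<open>0\<close> and \<open>\<mu>\<close> matter.  At \<open>\<mu>\<close> both sides are of order
  \<open>1 - \<mu>\<close>; that they vanish together is what keeps the constant in \<open>momentum_poly_bound\<close>
  independent of the spectral gap.
\<close>
lemma discriminant_bound: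
  fixes l \<mu> s :: real
  assumes l: "0 \<le> l" "l \<le> \<mu>" and \<mu>: "\<mu> < 1" and s: "0 \<le> s" "s\<^sup>2 = 1 - \<mu>\<^sup>2"
  shows "4 * (2 + s) * (1 + s) * (1 - l) \<le> 3 * (4 * (1 + s) - (2 + s)\<^sup>2 * l\<^sup>2)"
proof -
  have s1: "s \<le> 1" using s by (smt (verit) zero_le_power2 power2_le_imp_le one_power2)
  have "4 * (2 + s) \<le> 3 * (1 + \<mu>) * (3 + s)"
  proof -
    have "4 * (2 + s) \<le> 3 * (3 + s)" using s1 by simp
    also have "\<dots> \<le> 3 * (1 + \<mu>) * (3 + s)"
      using l s by (intro mult_right_mono) auto
    finally show ?thesis .
  qed
  then have "4 * (2 + s) * ((1 + s) * (1 - \<mu>)) \<le> 3 * (1 + \<mu>) * (3 + s) * ((1 + s) * (1 - \<mu>))"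
    using \<mu> s by (intro mult_right_mono) auto
  also have "\<dots> = 3 * (3 + s) * (1 + s) * s\<^sup>2"
    unfolding s(2) by (simp add: algebra_simps power2_eq_square)
  also have "\<dots> = 3 * (4 * (1 + s) - (2 + s)\<^sup>2 * \<mu>\<^sup>2)"
  proof -
    have \<mu>2: "\<mu>\<^sup>2 = 1 - s\<^sup>2" using s by simp
    show ?thesis unfolding \<mu>2 by (simp add: algebra_simps power2_eq_square)
  qed
  finally have right: "4 * (2 + s) * (1 + s) * (1 - \<mu>) + 3 * ((2 + s)\<^sup>2 * \<mu>\<^sup>2) - 12 * (1 + s) \<le> 0"
    by (simp add: algebra_simps)
  have left: "4 * (2 + s) * (1 + s) - 12 * (1 + s) \<le> 0"
  proof -
    have "(1 + s) * (s - 1) \<le> 0" using s s1 by (simp add: mult_nonneg_nonpos)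
    then show ?thesis by (simp add: algebra_simps)
  qed
  \<comment> \<open>Replacing \<open>l\<^sup>2\<close> by its chord \<open>\<mu> * l\<close> makes the claim affine in \<open>l\<close>.\<close>
  have "l\<^sup>2 \<le> \<mu> * l" using l by (simp add: power2_eq_square mult_right_mono)
  then have sq: "(2 + s)\<^sup>2 * l\<^sup>2 \<le> (2 + s)\<^sup>2 * (\<mu> * l)" by (intro mult_left_mono) auto
  show ?thesis
  proof (cases "\<mu> = 0")
    case True
    then show ?thesis using l left by (simp add: algebra_simps)
  next
    case False
    then have \<mu>0: "\<mu> > 0" using l by linarith
    define A B C where "A = 4 * (2 + s) * (1 + s)" and "B = 3 * (2 + s)\<^sup>2" and "C = 12 * (1 + s)"
    have r: "A * (1 - \<mu>) + B * \<mu>\<^sup>2 - C \<le> 0" and le: "A - C \<le> 0"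
      using right left unfolding A_def B_def C_def by (simp_all add: algebra_simps)
    have "\<mu> * (A * (1 - l) + B * (\<mu> * l) - C)
        = l * (A * (1 - \<mu>) + B * \<mu>\<^sup>2 - C) + (\<mu> - l) * (A - C)"
      by (simp add: algebra_simps power2_eq_square)
    also have "\<dots> \<le> 0"
      using r le l by (intro add_nonpos_nonpos mult_nonneg_nonpos) auto
    finally have "A * (1 - l) + B * (\<mu> * l) - C \<le> 0"
      using \<mu>0 by (simp add: mult_le_0_iff)
    then show ?thesis using sq unfolding A_def B_def C_def by (simp add: algebra_simps)
  qed
qed

text \<open>
  Completing the square in the energy bounds \<open>D / 4\<close> times the square of the polynomial, where
  \<open>- D\<close> is the discriminant, by the energy; \<open>D > 0\<close> says that the characteristic roots are complex,
  so that \<open>sqrt \<eta>\<close> is their modulus.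
\<close>
lemma momentum_poly_bound:
  fixes l \<mu> :: real
  assumes l: "0 \<le> l" "l \<le> \<mu>" and \<mu>: "\<mu> < 1"
  defines "\<eta> \<equiv> 1 / (1 + sqrt (1 - \<mu>\<^sup>2))"
  shows "(momentum_poly \<eta> l k)\<^sup>2 \<le> 3 * \<eta> ^ k"
proof -
  define s where "s = sqrt (1 - \<mu>\<^sup>2)"
  have "\<mu>\<^sup>2 \<le> 1" using l \<mu> by (simp add: power_le_one)
  then have s: "0 \<le> s" "s\<^sup>2 = 1 - \<mu>\<^sup>2" unfolding s_def by auto
  have eta: "\<eta> = 1 / (1 + s)" "\<eta> > 0" unfolding \<eta>_def s_def[symmetric] using s by auto
  define N where "N = 4 * (1 + \<eta>) * (1 - l)"
  define D where "D = 4 * \<eta> - (1 + \<eta>)\<^sup>2 * l\<^sup>2"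
  have eq: "1 + \<eta> = (2 + s) / (1 + s)" using eta s by (simp add: field_simps)
  have N: "N = 4 * (2 + s) * (1 + s) * (1 - l) / (1 + s)\<^sup>2"
    unfolding N_def eq using s by (simp add: power2_eq_square)
  have D: "D = (4 * (1 + s) - (2 + s)\<^sup>2 * l\<^sup>2) / (1 + s)\<^sup>2"
  proof -
    have "\<eta> = (1 + s) / (1 + s)\<^sup>2" using eta(1) s by (simp add: power2_eq_square)
    then show ?thesis unfolding D_def eq by (simp add: power_divide diff_divide_distrib)
  qed
  have ND: "N \<le> 3 * D"
    unfolding N D using discriminant_bound[OF l \<mu> s] s by (simp add: divide_right_mono)
  have "N > 0" unfolding N_def using \<open>\<eta> > 0\<close> l \<mu> by (intro mult_pos_pos) auto
  then have "D > 0" using ND by linarith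
  define p q where "p = momentum_poly \<eta> l k" and "q = momentum_poly \<eta> l (Suc k)"
  have "D * p\<^sup>2 \<le> D * p\<^sup>2 + (2 * q - (1 + \<eta>) * l * p)\<^sup>2" by simp
  also have "\<dots> = 4 * (q\<^sup>2 - (1 + \<eta>) * l * q * p + \<eta> * p\<^sup>2)"
    unfolding D_def by (simp add: algebra_simps power2_eq_square)
  also have "\<dots> = \<eta> ^ k * N"
    unfolding p_def q_def momentum_poly_energy N_def by simp
  also have "\<dots> \<le> \<eta> ^ k * (3 * D)"
    using ND eta by (intro mult_left_mono) auto
  finally have "D * p\<^sup>2 \<le> D * (3 * \<eta> ^ k)" by (simp add: algebra_simps)
  then show ?thesis using \<open>D > 0\<close> unfolding p_def by simp
qed

text \<open>
  Since \<open>sqrt (1 - \<mu>\<^sup>2) \<ge> q\<close> for \<open>q = sqrt (1 - \<mu>)\<close>, it suffices that \<open>(1 + q) powr (1 / q) \<ge> 2\<close>,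
  which is the weighted inequality of means for \<open>2\<close> and \<open>1\<close>; the 15 in \<open>K\<close> becomes the exponent.
\<close>
lemma momentum_factor_bound:
  fixes \<mu> :: real
  assumes \<mu>: "0 \<le> \<mu>" "\<mu> < 1"
  shows "(1 / (1 + sqrt (1 - \<mu>\<^sup>2))) ^ nat \<lceil>15 / sqrt (1 - \<mu>)\<rceil> \<le> 1 / 2 ^ 15"
proof -
  define q where "q = sqrt (1 - \<mu>)"
  define K where "K = nat \<lceil>15 / q\<rceil>"
  have q: "0 < q" "q \<le> 1" using \<mu> unfolding q_def by auto
  have "\<mu>\<^sup>2 \<le> \<mu>" using \<mu> by (simp add: power2_eq_square mult_left_le)
  then have qs: "q \<le> sqrt (1 - \<mu>\<^sup>2)" unfolding q_def by simp
  have "2 \<le> (1 + q) powr (1 / q)"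
  proof -
    have "2 powr q \<le> 1 + q"
      using Youngs_inequality_0[of q "1 - q" 2 1] q by simp
    then have "(2 powr q) powr (1 / q) \<le> (1 + q) powr (1 / q)"
      using q by (intro powr_mono2) auto
    then show ?thesis using q by (simp add: powr_powr)
  qed
  then have "2 ^ 15 \<le> ((1 + q) powr (1 / q)) ^ 15" by (intro power_mono) auto
  also have "\<dots> = (1 + q) powr (15 / q)" using q by (simp add: powr_power)
  also have "\<dots> \<le> (1 + q) powr real K" unfolding K_def using q by (intro powr_mono) linarith+
  also have "\<dots> = (1 + q) ^ K" using q by (simp add: powr_realpow)
  also have "\<dots> \<le> (1 + sqrt (1 - \<mu>\<^sup>2)) ^ K" using qs q by (intro power_mono) auto
  finally have "1 / (1 + sqrt (1 - \<mu>\<^sup>2)) ^ K \<le> 1 / 2 ^ 15" by (intro divide_left_mono) auto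
  then show ?thesis unfolding K_def q_def by (simp add: power_one_over)
qed

section \<open>Averages, deviations and the contraction of FastMix\<close>

definition consensus :: "real^'d \<Rightarrow> real^'d^'m" where
  "consensus a = (\<chi> i. a)"

definition deviation :: "real^'d^'m \<Rightarrow> real^'d^'m" where
  "deviation X = X - consensus (row_average X)"

lemma norm_sq_rows:
  fixes X :: "real^'d^'m"
  shows "(norm X)\<^sup>2 = (\<Sum>i\<in>UNIV. (norm (X $ i))\<^sup>2)"
  by (simp add: power2_norm_eq_inner inner_vec_def)

lemma row_average_vector_matrix:
  fixes X :: "real^'d^'m"
  shows "row_average X = (1 / real CARD('m)) *\<^sub>R (1 v* X)"
  by (simp add: row_average_def vector_matrix_mult_def vec_eq_iff sum_component)

lemma row_average_simps [simp]:
  fixes X Y :: "real^'d^'m"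
  shows "row_average (X + Y) = row_average X + row_average Y"
    and "row_average (X - Y) = row_average X - row_average Y"
    and "row_average (c *\<^sub>R X) = c *\<^sub>R row_average X"
    and "row_average (consensus a :: real^'d^'m) = a"
  by (simp_all add: row_average_def consensus_def sum.distrib sum_subtractf scaleR_add_right
      scaleR_diff_right scaleR_sum_right[symmetric] scaleR_left_commute sum_constant_scaleR del: sum_constant)

lemma sum_rows:
  fixes X :: "real^'d^'m"
  shows "(\<Sum>i\<in>UNIV. X $ i) = real CARD('m) *\<^sub>R row_average X"
  by (simp add: row_average_def)

lemma consensus_simps:
  "consensus (a + b) = consensus a + consensus b"
  "consensus (a - b) = consensus a - consensus b"
  "consensus (c *\<^sub>R a) = c *\<^sub>R consensus a"
  by (simp_all add: consensus_def vec_eq_iff)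

lemma norm_sq_consensus: "(norm (consensus a :: real^'d^'m))\<^sup>2 = real CARD('m) * (norm a)\<^sup>2"
  by (simp add: norm_sq_rows consensus_def)

lemma norm_consensus: "norm (consensus a :: real^'d^'m) = sqrt (real CARD('m)) * norm a"
  using arg_cong[OF norm_sq_consensus[where 'm='m, of a], of sqrt] by (simp add: real_sqrt_mult)

lemma deviation_simps:
  "deviation (X + Y) = deviation X + deviation Y"
  "deviation (X - Y) = deviation X - deviation Y"
  "deviation (c *\<^sub>R X) = c *\<^sub>R deviation X"
  "deviation (consensus a) = 0"
  by (simp_all add: deviation_def consensus_simps algebra_simps)

lemma row_average_deviation [simp]: "row_average (deviation X) = 0"
  by (simp add: deviation_def)

lemma inner_consensus:
  fixes X :: "real^'d^'m"
  shows "X \<bullet> consensus a = real CARD('m) * (row_average X \<bullet> a)"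
proof -
  have "X \<bullet> consensus a = (\<Sum>i\<in>UNIV. X $ i) \<bullet> a"
    unfolding inner_sum_left by (simp add: inner_vec_def[of X] consensus_def)
  then show ?thesis by (simp add: sum_rows)
qed

lemma inner_split_average:
  fixes X Y :: "real^'d^'m"
  shows "X \<bullet> Y = deviation X \<bullet> deviation Y + real CARD('m) * (row_average X \<bullet> row_average Y)"
proof -
  have "deviation X \<bullet> deviation Y = deviation X \<bullet> Y - deviation X \<bullet> consensus (row_average Y)"
    by (simp add: deviation_def[of Y] inner_diff_right)
  also have "\<dots> = X \<bullet> Y - Y \<bullet> consensus (row_average X)"
    unfolding inner_consensus row_average_deviation
    by (simp add: deviation_def inner_diff_left inner_commute[of "consensus _"] inner_consensus)
  finally show ?thesis by (simp add: inner_consensus inner_commute)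
qed

lemma norm_sq_split_average:
  fixes X :: "real^'d^'m"
  shows "(norm X)\<^sup>2 = (norm (deviation X))\<^sup>2 + real CARD('m) * (norm (row_average X))\<^sup>2"
  unfolding power2_norm_eq_inner by (rule inner_split_average)

lemma norm_sq_diff_consensus:
  fixes X :: "real^'d^'m"
  shows "(norm (X - consensus a))\<^sup>2 =
    (norm (deviation X))\<^sup>2 + real CARD('m) * (norm (row_average X - a))\<^sup>2"
  by (simp add: norm_sq_split_average[of "X - consensus a"] deviation_simps)

lemma norm_deviation_le: "norm (deviation X) \<le> norm (X - consensus a)"
  by (rule power2_le_imp_le) (auto simp: norm_sq_diff_consensus)

lemma norm_diff_consensus_le:
  fixes X :: "real^'d^'m"
  shows "norm (X - consensus a) \<le>
    norm (deviation X) + sqrt (real CARD('m)) * norm (row_average X - a)"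
proof -
  have "X - consensus a = deviation X + consensus (row_average X - a)"
    by (simp add: deviation_def consensus_simps)
  then show ?thesis using norm_triangle_ineq[of "deviation X" "consensus (row_average X - a)"] by (simp add: norm_consensus)
qed

lemma parseval_rows:
  fixes X :: "real^'d^'m"
  assumes "finite B" "span B = UNIV" "pairwise orthogonal B" "\<And>b. b \<in> B \<Longrightarrow> norm b = 1"
  shows "(norm X)\<^sup>2 = (\<Sum>b\<in>B. (norm (b v* X))\<^sup>2)"
proof -
  have "(norm X)\<^sup>2 = (\<Sum>i\<in>UNIV. \<Sum>j\<in>UNIV. (X $ i $ j)\<^sup>2)"
    unfolding power2_norm_eq_inner by (simp add: inner_vec_def power2_eq_square)
  also have "\<dots> = (\<Sum>j\<in>UNIV. (norm (column j X))\<^sup>2)"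
    unfolding power2_norm_eq_inner
    by (subst sum.swap) (simp add: inner_vec_def power2_eq_square column_def)
  also have "\<dots> = (\<Sum>j\<in>UNIV. \<Sum>b\<in>B. (b \<bullet> column j X)\<^sup>2)"
    by (intro sum.cong refl parseval[OF assms])
  also have "\<dots> = (\<Sum>b\<in>B. (norm (b v* X))\<^sup>2)"
    unfolding power2_norm_eq_inner
    by (subst sum.swap)
      (simp add: inner_vec_def power2_eq_square column_def vector_matrix_mult_def)
  finally show ?thesis .
qed

text \<open>
  For a row vector \<open>b\<close>, the product \<open>b v* X\<close> is the vector of components of all columns of \<open>X\<close> along
  \<open>b\<close>, so that the columns need not be treated one by one.
\<close>
lemma eigenvector_fastmix:
  fixes X :: "real^'d^'m"
  assumes W: "transpose W = W" and b: "W *v b = l *s b"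
  shows "b v* fastmix_iter W X k
    = momentum_poly (1 / (1 + sqrt (1 - (lambda2 W)\<^sup>2))) l k *\<^sub>R (b v* X)"
proof (induction k rule: induct_nat_012)
  case (ge2 k)
  have "b v* (W ** Y) = l *\<^sub>R (b v* Y)" for Y :: "real^'d^'m"
  proof -
    have "b v* (W ** Y) = (b v* W) v* Y" by (simp add: vector_matrix_mul_assoc)
    also have "b v* W = l *\<^sub>R b"
      using b W by (metis transpose_matrix_vector scalar_mult_eq_scaleR)
    finally show ?thesis by (simp add: scaleR_vector_matrix_assoc)
  qed
  then show ?case
    by (simp add: Let_def vector_matrix_mult_diff_rdistrib vector_scaleR_matrix_ac ge2
        scaleR_diff_left algebra_simps)
qed simp_all

lemma row_average_FastMix:
  fixes X :: "real^'d^'m"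
  assumes "transpose W = W" and "W *v 1 = 1"
  shows "row_average (FastMix W K X) = row_average X"
proof -
  have "momentum_poly \<eta> 1 k = 1" for \<eta> k
    by (induction k rule: induct_nat_012) auto
  then show ?thesis
    using eigenvector_fastmix[OF assms(1), of 1 1 X K] assms(2)
    by (simp add: row_average_vector_matrix FastMix_def)
qed

lemma vector_matrix_consensus: "b v* consensus a = (b \<bullet> 1) *\<^sub>R a"
  by (simp add: vec_eq_iff vector_matrix_mult_def consensus_def inner_vec_def sum_distrib_right)

text \<open>
  Compare components along an orthonormal eigenbasis.  Those along \<open>1\<close> vanish for a deviation; every
  other eigenvalue lies in \<open>[0, \<lambda>\<^sub>2]\<close>, where the absolute value of the momentum
  polynomial is at most \<open>sqrt (3 / 2 ^ 15) < 1 / 100\<close>.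
\<close>
lemma FastMix_contracts_deviation:
  fixes X :: "real^'d^'m"
  assumes W: "weight_matrix E W" and m: "CARD('m) \<ge> 2"
  defines "K \<equiv> nat \<lceil>15 / sqrt (1 - lambda2 W)\<rceil>"
  shows "norm (deviation (FastMix W K X)) \<le> norm (deviation X) / 100"
proof -
  have sym: "transpose W = W" and one: "W *v 1 = 1" using W by (auto simp: weight_matrix_def)
  note spec = weight_matrix_spectrum[OF W m]
  define \<eta> where "\<eta> = 1 / (1 + sqrt (1 - (lambda2 W)\<^sup>2))"
  obtain B where B: "finite B" "span B = (UNIV :: (real^'m) set)" "pairwise orthogonal B"
    "\<And>b. b \<in> B \<Longrightarrow> norm b = 1" "\<And>b. b \<in> B \<Longrightarrow> \<exists>l. W *v b = l *s b"
    using symmetric_matrix_orthonormal_eigenbasis[OF sym] by blast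
  have comp: "(norm (b v* deviation (FastMix W K X)))\<^sup>2 \<le> (1 / 100)\<^sup>2 * (norm (b v* deviation X))\<^sup>2"
    if bB: "b \<in> B" for b
  proof (cases "b \<in> span {1}")
    case True
    then obtain c where c: "b = c *\<^sub>R 1" by (auto simp: span_singleton)
    have "1 v* deviation Y = 0" for Y :: "real^'d^'m"
      using row_average_deviation[of Y] by (simp add: row_average_vector_matrix)
    then show ?thesis by (simp add: c scaleR_vector_matrix_assoc)
  next
    case False
    obtain l where l: "W *v b = l *s b" using B(5)[OF bB] by blast
    have "b \<noteq> 0" using B(4)[OF bB] by auto
    then have range: "0 \<le> l" "l \<le> lambda2 W" using spec(3)[OF _ l] False by blast+
    have "(W *v b) \<bullet> 1 = b \<bullet> (W *v 1)"
      by (metis sym dot_lmul_matrix vector_transpose_matrix)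
    then have "l * (b \<bullet> 1) = b \<bullet> 1" unfolding l one by (simp add: scalar_mult_eq_scaleR)
    then have "b \<bullet> 1 = 0" using range spec(2) by auto
    then have dev: "b v* deviation Y = b v* Y" for Y :: "real^'d^'m"
      by (simp add: deviation_def vector_matrix_mult_diff_rdistrib vector_matrix_consensus)
    have "(momentum_poly \<eta> l K)\<^sup>2 \<le> 3 * (1 / 2 ^ 15)"
      using momentum_poly_bound[OF range spec(2), of K] momentum_factor_bound[OF spec(1,2)]
      unfolding \<eta>_def K_def by linarith
    also have "\<dots> \<le> (1 / 100 :: real)\<^sup>2" by (simp add: power2_eq_square)
    finally show ?thesis
      unfolding dev FastMix_def eigenvector_fastmix[OF sym l] \<eta>_def[symmetric]
      by (simp add: power_mult_distrib mult_right_mono)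
  qed
  have "(norm (deviation (FastMix W K X)))\<^sup>2 = (\<Sum>b\<in>B. (norm (b v* deviation (FastMix W K X)))\<^sup>2)"
    by (rule parseval_rows[OF B(1-4)])
  also have "\<dots> \<le> (\<Sum>b\<in>B. (1 / 100)\<^sup>2 * (norm (b v* deviation X))\<^sup>2)"
    by (intro sum_mono comp)
  also have "\<dots> = (1 / 100)\<^sup>2 * (norm (deviation X))\<^sup>2"
    unfolding sum_distrib_left[symmetric] by (simp only: parseval_rows[OF B(1-4), of "deviation X"])
  also have "\<dots> = (norm (deviation X) / 100)\<^sup>2" by (simp add: power_divide)
  finally show ?thesis by (rule power2_le_imp_le) simp
qed

section \<open>Proximal maps and smooth convex functions\<close>

text \<open>
  A convex function decreases at most linearly: it is bounded on the unit sphere around \<open>v\<close>, and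
  the value at \<open>w\<close> is at least the extrapolation from \<open>v\<close> through the point of the sphere
  between them.  This makes the quadratic term of the proximal problem dominate.
\<close>
lemma convex_lower_growth:
  fixes g :: "'a::euclidean_space \<Rightarrow> real"
  assumes "convex_on UNIV g"
  obtains c where "c \<ge> 0" "\<And>w. norm (w - v) \<ge> 1 \<Longrightarrow> g v - c * norm (w - v) \<le> g w"
proof -
  have "continuous_on UNIV g" using assms by (intro convex_on_continuous) auto
  then have "continuous_on (sphere v 1) g" by (rule continuous_on_subset) auto
  then have "bounded (g ` sphere v 1)"
    by (intro compact_imp_bounded compact_continuous_image) auto
  then obtain M where M: "M > 0" "\<And>u. u \<in> sphere v 1 \<Longrightarrow> \<bar>g u\<bar> \<le> M"
    unfolding bounded_pos by auto
  show ?thesis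
  proof
    show "0 \<le> M + \<bar>g v\<bar>" using M(1) by simp
    fix w assume w: "norm (w - v) \<ge> 1"
    define r where "r = norm (w - v)"
    define u where "u = (1 - 1 / r) *\<^sub>R v + (1 / r) *\<^sub>R w"
    have r: "r \<ge> 1" using w r_def by simp
    have "u - v = (1 / r) *\<^sub>R (w - v)" unfolding u_def by (simp add: algebra_simps)
    then have "norm (u - v) = (1 / r) * r" using r unfolding r_def by simp
    then have "norm (u - v) = 1" using r by simp
    then have "u \<in> sphere v 1" by (simp add: dist_norm norm_minus_commute)
    then have "- M \<le> g u" using M(2)[of u] by linarith
    also have "g u \<le> (1 - 1 / r) * g v + (1 / r) * g w"
      unfolding u_def using convex_onD[OF assms, of "1 / r" v w] r by simp
    finally have "r * (- M) \<le> r * ((1 - 1 / r) * g v + (1 / r) * g w)"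
      using r by (intro mult_left_mono) auto
    also have "\<dots> = r * g v - g v + g w" using r by (simp add: field_simps)
    finally have "g w \<ge> g v - r * M - r * g v" by simp
    moreover have "r * g v \<le> r * \<bar>g v\<bar>" using r by (intro mult_left_mono) auto
    ultimately show "g v - (M + \<bar>g v\<bar>) * norm (w - v) \<le> g w"
      unfolding r_def[symmetric] by (simp add: algebra_simps)
  qed
qed

lemma prox_minimizer_exists:
  fixes g :: "'a::euclidean_space \<Rightarrow> real"
  assumes g: "convex_on UNIV g" and \<gamma>: "\<gamma> > 0"
  shows "\<exists>p. \<forall>w. \<gamma> * g p + 1 / 2 * (norm (p - v))\<^sup>2 \<le> \<gamma> * g w + 1 / 2 * (norm (w - v))\<^sup>2"
proof -
  let ?\<phi> = "\<lambda>w. \<gamma> * g w + 1 / 2 * (norm (w - v))\<^sup>2"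
  obtain c where c: "c \<ge> 0" "\<And>w. norm (w - v) \<ge> 1 \<Longrightarrow> g v - c * norm (w - v) \<le> g w"
    using convex_lower_growth[OF g] by blast
  \<comment> \<open>Beyond this radius the linear decrease of \<open>\<gamma> * g\<close> is at most half the squared distance.\<close>
  define R where "R = max 1 (2 * \<gamma> * c)"
  have "continuous_on UNIV g" using g by (intro convex_on_continuous) auto
  then have "continuous_on (cball v R) ?\<phi>"
    by (intro continuous_intros) (auto intro: continuous_on_subset)
  moreover have "cball v R \<noteq> {}" unfolding R_def by auto
  ultimately obtain p where p: "\<And>w. w \<in> cball v R \<Longrightarrow> ?\<phi> p \<le> ?\<phi> w"
    using continuous_attains_inf[of "cball v R" ?\<phi>] by (auto simp del: mem_cball)
  have "?\<phi> p \<le> ?\<phi> w" for w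
  proof (cases "w \<in> cball v R")
    case False
    define r where "r = norm (w - v)"
    have r: "r \<ge> 1" "r \<ge> 2 * \<gamma> * c"
      using False unfolding r_def R_def by (auto simp: dist_norm norm_minus_commute)
    have "\<gamma> * (g v - c * r) \<le> \<gamma> * g w"
      using c(2)[of w] r(1) \<gamma> unfolding r_def by (intro mult_left_mono) auto
    moreover have "(2 * \<gamma> * c) * r \<le> r * r" using r by (intro mult_right_mono) auto
    ultimately have "\<gamma> * g v \<le> ?\<phi> w"
      unfolding r_def[symmetric] by (simp add: algebra_simps power2_eq_square)
    moreover have "?\<phi> p \<le> ?\<phi> v" using p[of v] unfolding R_def by simp
    ultimately show ?thesis by simp
  qed (rule p)
  then show ?thesis by blast
qed

lemma prox_minimizes:
  fixes g :: "'a::euclidean_space \<Rightarrow> real"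
  assumes "convex_on UNIV g" and "\<gamma> > 0"
  shows "\<gamma> * g (prox \<gamma> g v) + 1 / 2 * (norm (prox \<gamma> g v - v))\<^sup>2
    \<le> \<gamma> * g w + 1 / 2 * (norm (w - v))\<^sup>2"
proof -
  let ?\<phi> = "\<lambda>w. \<gamma> * g w + 1 / 2 * (norm (w - v))\<^sup>2"
  have "\<exists>p. is_arg_min ?\<phi> (\<lambda>_. True) p"
    using prox_minimizer_exists[OF assms, of v] by (auto simp: is_arg_min_linorder)
  then have "is_arg_min ?\<phi> (\<lambda>_. True) (prox \<gamma> g v)"
    unfolding prox_def arg_min_def by (rule someI_ex)
  then show ?thesis by (simp add: is_arg_min_linorder)
qed

text \<open>
  First-order optimality of the proximal point in the direction of \<open>w\<close>: compare it with the point
  at fraction \<open>t\<close> of the way to \<open>w\<close> and let \<open>t\<close> tend to \<open>0\<close>.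
\<close>
lemma prox_variational_inequality:
  fixes g :: "'a::euclidean_space \<Rightarrow> real"
  assumes g: "convex_on UNIV g" and \<gamma>: "\<gamma> > 0"
  shows "\<gamma> * g (prox \<gamma> g v) + (v - prox \<gamma> g v) \<bullet> (w - prox \<gamma> g v) \<le> \<gamma> * g w"
proof -
  define p where "p = prox \<gamma> g v"
  define a where "a = \<gamma> * (g p - g w) + (v - p) \<bullet> (w - p)"
  define b where "b = (norm (w - p))\<^sup>2 / 2"
  have a: "a \<le> t * b" if t: "0 < t" "t \<le> 1" for t
  proof -
    define q where "q = (1 - t) *\<^sub>R p + t *\<^sub>R w"
    have "\<gamma> * g p + 1 / 2 * (norm (p - v))\<^sup>2 \<le> \<gamma> * g q + 1 / 2 * (norm (q - v))\<^sup>2"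
      unfolding p_def by (rule prox_minimizes[OF g \<gamma>])
    moreover have "\<gamma> * g q \<le> \<gamma> * ((1 - t) * g p + t * g w)"
      unfolding q_def using \<gamma> t convex_onD[OF g, of t p w] by (intro mult_left_mono) auto
    moreover have "(norm (q - v))\<^sup>2
      = (norm (p - v))\<^sup>2 - 2 * t * ((v - p) \<bullet> (w - p)) + t\<^sup>2 * (norm (w - p))\<^sup>2"
    proof -
      have "q - v = (p - v) + t *\<^sub>R (w - p)" unfolding q_def by (simp add: algebra_simps)
      moreover have "(p - v) \<bullet> (w - p) = - ((v - p) \<bullet> (w - p))"
        by (metis inner_minus_left minus_diff_eq)
      ultimately show ?thesis
        by (simp only: power2_norm_eq_inner)
          (simp add: inner_add_left inner_add_right inner_commute[of "w - p" "p - v"]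
            power2_eq_square right_diff_distrib)
    qed
    ultimately have "t * a \<le> t * (t * b)"
      unfolding a_def b_def by (simp add: algebra_simps power2_eq_square)
    then show ?thesis using t by simp
  qed
  have "a \<le> 0"
  proof (rule ccontr)
    assume "\<not> a \<le> 0"
    then have a0: "a > 0" by simp
    then have b0: "b > 0" using a[of 1] by simp
    define t where "t = min 1 (a / (2 * b))"
    have "a \<le> t * b" using a0 b0 unfolding t_def by (intro a) auto
    also have "\<dots> \<le> a / (2 * b) * b" using b0 unfolding t_def by (intro mult_right_mono) auto
    finally show False using a0 b0 by simp
  qed
  then show ?thesis unfolding a_def p_def by (simp add: algebra_simps)
qed

lemma prox_nonexpansive:
  fixes g :: "'a::euclidean_space \<Rightarrow> real"
  assumes g: "convex_on UNIV g" and \<gamma>: "\<gamma> > 0"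
  shows "norm (prox \<gamma> g u - prox \<gamma> g v) \<le> norm (u - v)"
proof -
  define p q where "p = prox \<gamma> g u" and "q = prox \<gamma> g v"
  have "(u - p) \<bullet> (q - p) + (v - q) \<bullet> (p - q) \<le> 0"
    using prox_variational_inequality[OF g \<gamma>, of u q] prox_variational_inequality[OF g \<gamma>, of v p]
    unfolding p_def q_def by linarith
  then have "(p - q) \<bullet> (p - q) \<le> (u - v) \<bullet> (p - q)"
    by (simp add: inner_diff inner_commute algebra_simps)
  also have "\<dots> \<le> norm (u - v) * norm (p - q)" by (rule norm_cauchy_schwarz)
  finally have "norm (p - q) * norm (p - q) \<le> norm (u - v) * norm (p - q)"
    by (simp add: norm_eq_sqrt_inner)
  then show ?thesis
    unfolding p_def q_def by (metis mult_right_le_imp_le norm_ge_zero order_le_less)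
qed

text \<open>
  The linear lower model at \<open>x\<close> lies below the quadratic upper model at \<open>y\<close>.  The claim is this
  comparison at the point \<open>z\<close> where the two models are closest.
\<close>
lemma convex_smooth_cocoercive:
  fixes f :: "'a::real_inner \<Rightarrow> real"
  assumes f: "convex_smooth L f" and L: "L > 0"
  shows "f x + gradient f x \<bullet> (y - x) + (norm (gradient f y - gradient f x))\<^sup>2 / (2 * L) \<le> f y"
proof -
  define h where "h = gradient f y - gradient f x"
  define z where "z = y - h /\<^sub>R L"
  have "f x + gradient f x \<bullet> (z - x) \<le> f z" using f by (simp add: convex_smooth_def)
  also have "f z \<le> f y + gradient f y \<bullet> (z - y) + L / 2 * (norm (y - z))\<^sup>2"
    using f by (simp add: convex_smooth_def)
  finally have "f x + gradient f x \<bullet> (z - x) - gradient f y \<bullet> (z - y) - L / 2 * (norm (y - z))\<^sup>2 \<le> f y"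
    by simp
  moreover have "gradient f x \<bullet> (z - x) = gradient f x \<bullet> (z - y) + gradient f x \<bullet> (y - x)"
    by (simp add: inner_diff_right)
  moreover have "gradient f y \<bullet> (z - y) - gradient f x \<bullet> (z - y) = - ((norm h)\<^sup>2 / L)"
    unfolding inner_diff_left[symmetric] h_def[symmetric] z_def
    by (simp add: power2_norm_eq_inner field_simps)
  moreover have "L / 2 * (norm (y - z))\<^sup>2 = (norm h)\<^sup>2 / (2 * L)"
    unfolding z_def using L by (simp add: power2_eq_square field_simps)
  moreover have "(norm h)\<^sup>2 / L = 2 * ((norm h)\<^sup>2 / (2 * L))" by simp
  ultimately show ?thesis unfolding h_def[symmetric] by linarith
qed

lemma convex_smooth_gradient_lipschitz:
  fixes f :: "'a::real_inner \<Rightarrow> real"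
  assumes f: "convex_smooth L f" and L: "L > 0"
  shows "norm (gradient f x - gradient f y) \<le> L * norm (x - y)"
proof -
  define h where "h = gradient f x - gradient f y"
  have "(norm h)\<^sup>2 / L = (norm (gradient f y - gradient f x))\<^sup>2 / (2 * L) + (norm h)\<^sup>2 / (2 * L)"
    unfolding h_def by (simp add: norm_minus_commute)
  also have "\<dots> \<le> h \<bullet> (x - y)"
    using convex_smooth_cocoercive[OF f L, of x y] convex_smooth_cocoercive[OF f L, of y x]
    unfolding h_def by (simp add: inner_diff)
  also have "\<dots> \<le> norm h * norm (x - y)" by (rule norm_cauchy_schwarz)
  finally have "norm h * norm h \<le> norm h * (L * norm (x - y))"
    using L by (simp add: field_simps power2_eq_square)
  then show ?thesis
    using L unfolding h_def[symmetric] by (cases "h = 0") auto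
qed

section \<open>One accelerated step with inexact gradients\<close>

lemma local_gradients_lipschitz:
  fixes f :: "'m::finite \<Rightarrow> real^'d \<Rightarrow> real"
  assumes f: "\<And>i. convex_smooth L (f i)" and L: "L > 0"
  shows "norm (local_gradients f X - local_gradients f Y) \<le> L * norm (X - Y)"
proof (rule power2_le_imp_le)
  have "(norm (local_gradients f X - local_gradients f Y))\<^sup>2
      \<le> (\<Sum>i\<in>UNIV. (L * norm (X $ i - Y $ i))\<^sup>2)"
    unfolding norm_sq_rows
    by (intro sum_mono power_mono)
      (simp_all add: local_gradients_def convex_smooth_gradient_lipschitz[OF f L])
  also have "\<dots> = (L * norm (X - Y))\<^sup>2"
    by (simp add: power_mult_distrib norm_sq_rows[of "X - Y"] sum_distrib_left)
  finally show "(norm (local_gradients f X - local_gradients f Y))\<^sup>2 \<le> (L * norm (X - Y))\<^sup>2" .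
qed (use L in simp)

lemma deviation_row_prox_le:
  fixes X :: "real^'d^'m"
  assumes g: "convex_on UNIV g" and \<gamma>: "\<gamma> > 0"
  shows "norm (deviation (row_prox \<gamma> g X)) \<le> norm (deviation X)"
proof (rule power2_le_imp_le)
  have "(norm (deviation (row_prox \<gamma> g X)))\<^sup>2
      \<le> (norm (row_prox \<gamma> g X - consensus (prox \<gamma> g (row_average X))))\<^sup>2"
    by (intro power_mono norm_deviation_le) simp
  also have "\<dots> \<le> (norm (deviation X))\<^sup>2"
    unfolding norm_sq_rows
    by (intro sum_mono power_mono)
      (simp_all add: row_prox_def consensus_def deviation_def prox_nonexpansive[OF g \<gamma>])
  finally show "(norm (deviation (row_prox \<gamma> g X)))\<^sup>2 \<le> (norm (deviation X))\<^sup>2" .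
qed simp

lemma convex_row_average_le:
  fixes X :: "real^'d^'m"
  assumes "convex_on UNIV g"
  shows "real CARD('m) * g (row_average X) \<le> (\<Sum>i\<in>UNIV. g (X $ i))"
proof -
  have "g (\<Sum>i\<in>UNIV. (1 / real CARD('m)) *\<^sub>R X $ i) \<le> (\<Sum>i\<in>UNIV. (1 / real CARD('m)) * g (X $ i))"
    by (intro convex_on_sum[OF _ _ assms]) auto
  then have "g (row_average X) \<le> (\<Sum>i\<in>UNIV. g (X $ i)) / real CARD('m)"
    by (simp add: row_average_def scaleR_sum_right sum_divide_distrib)
  then show ?thesis by (simp add: field_simps)
qed

text \<open>
  The average of the proximal points behaves like one proximal point of the average of the
  arguments, up to a quarter of the squared deviation of the arguments.  Averaging the variational
  inequalities of the rows and using Jensen's inequality for \<open>g\<close>, the inner products split into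
  that of the averages and \<open>(v - p) \<bullet> p\<close> for the deviations \<open>v\<close> and \<open>p\<close>, which is at most
  \<open>v \<bullet> v / 4\<close>.
\<close>
lemma averaged_prox_inequality:
  fixes V :: "real^'d^'m"
  assumes g: "convex_on UNIV g" and \<gamma>: "\<gamma> > 0"
  defines "p \<equiv> row_average (row_prox \<gamma> g V)"
  shows "real CARD('m) * (\<gamma> * g p + (row_average V - p) \<bullet> (w - p))
    \<le> real CARD('m) * (\<gamma> * g w) + (norm (deviation V))\<^sup>2 / 4"
proof -
  define m where "m = real CARD('m)"
  define P where "P = row_prox \<gamma> g V"
  have "(\<Sum>i\<in>UNIV. \<gamma> * g (P $ i) + (V $ i - P $ i) \<bullet> (w - P $ i)) \<le> (\<Sum>i\<in>(UNIV :: 'm set). \<gamma> * g w)"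
    unfolding P_def row_prox_def by (intro sum_mono) (simp add: prox_variational_inequality[OF g \<gamma>])
  also have "\<dots> = m * (\<gamma> * g w)" by (simp add: m_def)
  also have "(\<Sum>i\<in>UNIV. \<gamma> * g (P $ i) + (V $ i - P $ i) \<bullet> (w - P $ i))
      = \<gamma> * (\<Sum>i\<in>UNIV. g (P $ i)) + (V - P) \<bullet> (consensus w - P)"
    by (simp add: sum.distrib sum_distrib_left inner_vec_def[of "V - P"] consensus_def)
  finally have "\<gamma> * (\<Sum>i\<in>UNIV. g (P $ i)) + (V - P) \<bullet> (consensus w - P) \<le> m * (\<gamma> * g w)" .
  moreover have "\<gamma> * (m * g p) \<le> \<gamma> * (\<Sum>i\<in>UNIV. g (P $ i))"
    using \<gamma> convex_row_average_le[OF g, of P] unfolding p_def P_def m_def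
    by (intro mult_left_mono) auto
  moreover have "(V - P) \<bullet> (consensus w - P) = m * ((row_average V - p) \<bullet> (w - p))
      - (deviation V - deviation P) \<bullet> deviation P"
    unfolding inner_split_average[of "V - P"] p_def P_def[symmetric] m_def
    by (simp add: deviation_simps)
  moreover have "(deviation V - deviation P) \<bullet> deviation P \<le> (norm (deviation V))\<^sup>2 / 4"
  proof -
    have "(norm (deviation V))\<^sup>2 / 4 - (deviation V - deviation P) \<bullet> deviation P
        = (norm ((1 / 2) *\<^sub>R deviation V - deviation P))\<^sup>2"
      unfolding power2_norm_eq_inner by (simp add: inner_diff inner_commute)
    then show ?thesis by (smt (verit) zero_le_power2)
  qed
  ultimately show ?thesis unfolding m_def[symmetric] by (simp add: algebra_simps)
qed

text \<open>
  The sum of the linearizations of the \<open>f i\<close> at the rows of \<open>X\<close> is an affine function \<open>lin\<close> of the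
  common argument, with slope \<open>m\<close> times the average of \<open>S\<close>.  It is a lower bound of the sum of the
  \<open>f i\<close>, with a co-coercivity gap that is kept at \<open>y\<close>, and an upper bound up to a quadratic term,
  which contributes the deviation of \<open>X\<close> and the move from the average of \<open>X\<close> to \<open>y'\<close>; the latter is
  \<open>\<tau>\<close> times the move of the average of \<open>Z\<close>.  Combining the upper bound at \<open>y'\<close>, the lower bounds at
  \<open>y\<close> and \<open>w\<close>, and \<open>averaged_prox_inequality\<close> gives the usual estimate of accelerated methods.
\<close>
theorem accelerated_step:
  fixes f :: "'m::finite \<Rightarrow> real^'d \<Rightarrow> real" and X Z S :: "real^'d^'m" and y w :: "real^'d"
  assumes f: "\<And>i. convex_smooth L (f i)" and g: "convex_on UNIV g" and L: "L > 0"
    and \<gamma>: "\<gamma> > 0" and \<tau>: "0 \<le> \<tau>" "\<tau> \<le> 1"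
    and s: "row_average S = row_average (local_gradients f X)"
    and x: "row_average X = \<tau> *\<^sub>R row_average Z + (1 - \<tau>) *\<^sub>R y"
  defines "m \<equiv> real CARD('m)"
  defines "p \<equiv> row_average (row_prox \<gamma> g (Z - \<gamma> *\<^sub>R S))"
  defines "y' \<equiv> \<tau> *\<^sub>R p + (1 - \<tau>) *\<^sub>R y"
  defines "F \<equiv> objective f g"
  shows "m * (F y' - F w) + \<tau> / \<gamma> * (m / 2 * (norm (p - w))\<^sup>2)
    \<le> (1 - \<tau>) * (m * (F y - F w)) + \<tau> / \<gamma> * (m / 2 * (norm (row_average Z - w))\<^sup>2)
      - (1 - \<tau>) * (norm (local_gradients f (consensus y) - local_gradients f X))\<^sup>2 / (2 * L)
      - (\<tau> / \<gamma> - L * \<tau>\<^sup>2) * (m / 2 * (norm (p - row_average Z))\<^sup>2)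
      + \<tau> / \<gamma> * ((norm (deviation (Z - \<gamma> *\<^sub>R S)))\<^sup>2 / 4) + L / 2 * (norm (deviation X))\<^sup>2"
proof -
  define z where "z = row_average Z"
  define s' where "s' = row_average S"
  define lin where "lin v = (\<Sum>i\<in>UNIV. f i (X $ i) + gradient (f i) (X $ i) \<bullet> (v - X $ i))" for v
  have m: "m > 0" unfolding m_def by simp
  have F: "m * F v = (\<Sum>i\<in>UNIV. f i v) + m * g v" for v
    unfolding F_def objective_def m_def by (simp add: field_simps)
  have lin_diff: "lin u - lin v = m * (s' \<bullet> (u - v))" for u v
  proof -
    have "lin u - lin v = (\<Sum>i\<in>UNIV. local_gradients f X $ i) \<bullet> (u - v)"
      unfolding lin_def sum_subtractf[symmetric] inner_sum_left
      by (intro sum.cong) (simp_all add: local_gradients_def inner_diff_right)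
    then show ?thesis by (simp add: sum_rows s'_def s m_def)
  qed
  have lower: "lin v \<le> (\<Sum>i\<in>UNIV. f i v)" for v
    unfolding lin_def using f by (intro sum_mono) (simp add: convex_smooth_def)
  have lower': "lin v + (norm (local_gradients f (consensus v) - local_gradients f X))\<^sup>2 / (2 * L)
      \<le> (\<Sum>i\<in>UNIV. f i v)" for v
    unfolding lin_def norm_sq_rows sum_divide_distrib sum.distrib[symmetric]
    by (intro sum_mono) (simp add: local_gradients_def consensus_def convex_smooth_cocoercive[OF f L])
  have upper: "(\<Sum>i\<in>UNIV. f i v)
      \<le> lin v + L / 2 * ((norm (deviation X))\<^sup>2 + m * (norm (row_average X - v))\<^sup>2)" for v
    unfolding lin_def m_def norm_sq_diff_consensus[symmetric]
    unfolding norm_sq_rows sum_distrib_left sum.distrib[symmetric]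
    using f by (intro sum_mono) (simp add: convex_smooth_def consensus_def)
  have xy': "row_average X - y' = \<tau> *\<^sub>R (z - p)"
    unfolding x y'_def z_def by (simp add: algebra_simps)
  have lin_y': "lin y' = (1 - \<tau>) * lin y + \<tau> * (lin w + m * (s' \<bullet> (p - w)))"
  proof -
    have "lin y' - lin y = m * (s' \<bullet> (\<tau> *\<^sub>R (p - y)))"
      unfolding lin_diff y'_def by (simp add: algebra_simps)
    also have "\<dots> = \<tau> * (lin p - lin y)" unfolding lin_diff by simp
    finally have "lin y' = (1 - \<tau>) * lin y + \<tau> * lin p" by (simp add: algebra_simps)
    also have "lin p = lin w + m * (s' \<bullet> (p - w))" using lin_diff[of p w] by simp
    finally show ?thesis .
  qed
  have "(\<Sum>i\<in>UNIV. f i y') \<le> lin y' + L / 2 * ((norm (deviation X))\<^sup>2 + m * (norm (row_average X - y'))\<^sup>2)"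
    by (rule upper)
  also have "\<dots> = (1 - \<tau>) * lin y + \<tau> * lin w + \<tau> * (m * (s' \<bullet> (p - w)))
      + L / 2 * (norm (deviation X))\<^sup>2 + L * \<tau>\<^sup>2 * (m / 2 * (norm (p - z))\<^sup>2)"
    unfolding xy' norm_scaleR lin_y'
    by (simp add: power_mult_distrib norm_minus_commute[of z p] distrib_left right_diff_distrib)
  finally have f_y': "(\<Sum>i\<in>UNIV. f i y') \<le> (1 - \<tau>) * lin y + \<tau> * lin w + \<tau> * (m * (s' \<bullet> (p - w)))
      + L / 2 * (norm (deviation X))\<^sup>2 + L * \<tau>\<^sup>2 * (m / 2 * (norm (p - z))\<^sup>2)" .
  have lin_y: "(1 - \<tau>) * (lin y + (norm (local_gradients f (consensus y) - local_gradients f X))\<^sup>2 / (2 * L))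
      \<le> (1 - \<tau>) * (\<Sum>i\<in>UNIV. f i y)"
    using lower' \<tau> by (intro mult_left_mono) auto
  have lin_w: "\<tau> * lin w \<le> \<tau> * (\<Sum>i\<in>UNIV. f i w)"
    using lower \<tau> by (intro mult_left_mono) auto
  have g_y': "m * g y' \<le> m * ((1 - \<tau>) * g y + \<tau> * g p)"
    unfolding y'_def using m \<tau> convex_onD[OF g, of \<tau> y p]
    by (intro mult_left_mono) (simp_all add: add.commute)
  have three_point: "(z - p) \<bullet> (p - w)
      = (norm (z - w))\<^sup>2 / 2 - (norm (p - w))\<^sup>2 / 2 - (norm (p - z))\<^sup>2 / 2"
    unfolding power2_norm_eq_inner by (simp add: inner_diff inner_commute field_simps)
  have "m * (\<gamma> * g p + (z - \<gamma> *\<^sub>R s' - p) \<bullet> (w - p))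
      \<le> m * (\<gamma> * g w) + (norm (deviation (Z - \<gamma> *\<^sub>R S)))\<^sup>2 / 4"
    using averaged_prox_inequality[OF g \<gamma>, of "Z - \<gamma> *\<^sub>R S" w]
    unfolding p_def[symmetric] m_def[symmetric] by (simp add: z_def s'_def)
  moreover have "(z - \<gamma> *\<^sub>R s' - p) \<bullet> (w - p) = \<gamma> * (s' \<bullet> (p - w)) - (z - p) \<bullet> (p - w)"
    by (simp add: inner_diff algebra_simps)
  ultimately have "\<gamma> * (m * (g p - g w) + m * (s' \<bullet> (p - w)))
      \<le> m * ((z - p) \<bullet> (p - w)) + (norm (deviation (Z - \<gamma> *\<^sub>R S)))\<^sup>2 / 4"
    by (simp add: algebra_simps)
  then have "\<tau> / \<gamma> * (\<gamma> * (m * (g p - g w) + m * (s' \<bullet> (p - w))))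
      \<le> \<tau> / \<gamma> * (m * ((z - p) \<bullet> (p - w)) + (norm (deviation (Z - \<gamma> *\<^sub>R S)))\<^sup>2 / 4)"
    using \<tau> \<gamma> by (intro mult_left_mono) auto
  then have prox: "\<tau> * (m * (g p - g w)) + \<tau> * (m * (s' \<bullet> (p - w)))
      \<le> \<tau> / \<gamma> * (m / 2 * (norm (z - w))\<^sup>2) - \<tau> / \<gamma> * (m / 2 * (norm (p - w))\<^sup>2)
        - \<tau> / \<gamma> * (m / 2 * (norm (p - z))\<^sup>2)
        + \<tau> / \<gamma> * ((norm (deviation (Z - \<gamma> *\<^sub>R S)))\<^sup>2 / 4)"
    unfolding three_point using \<gamma> by (simp add: algebra_simps)
  have "m * (F y' - F w) = (\<Sum>i\<in>UNIV. f i y') + m * g y' - (\<Sum>i\<in>UNIV. f i w) - m * g w"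
    using F[of y'] F[of w] by (simp add: right_diff_distrib)
  moreover have "(1 - \<tau>) * (m * (F y - F w)) = (1 - \<tau>) * (\<Sum>i\<in>UNIV. f i y) + (1 - \<tau>) * (m * g y)
      - (\<Sum>i\<in>UNIV. f i w) - m * g w + \<tau> * (\<Sum>i\<in>UNIV. f i w) + \<tau> * (m * g w)"
    unfolding right_diff_distrib[of m] F by (simp add: algebra_simps)
  moreover have "m * ((1 - \<tau>) * g y + \<tau> * g p) = (1 - \<tau>) * (m * g y) + \<tau> * (m * g w) + \<tau> * (m * (g p - g w))"
    by (simp add: algebra_simps)
  moreover have "(1 - \<tau>) * (lin y + (norm (local_gradients f (consensus y) - local_gradients f X))\<^sup>2 / (2 * L))
      = (1 - \<tau>) * lin y
        + (1 - \<tau>) * (norm (local_gradients f (consensus y) - local_gradients f X))\<^sup>2 / (2 * L)"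
    by (simp add: distrib_left)
  moreover have "(\<tau> / \<gamma> - L * \<tau>\<^sup>2) * (m / 2 * (norm (p - z))\<^sup>2)
      = \<tau> / \<gamma> * (m / 2 * (norm (p - z))\<^sup>2) - L * \<tau>\<^sup>2 * (m / 2 * (norm (p - z))\<^sup>2)"
    by (simp add: left_diff_distrib)
  ultimately show ?thesis
    using f_y' lin_y lin_w g_y' prox unfolding z_def[symmetric] by linarith
qed

section \<open>A Lyapunov function for the algorithm\<close>

lemma square_sum3_le:
  fixes a b c :: real
  shows "(a + b + c)\<^sup>2 \<le> 3 * (a\<^sup>2 + b\<^sup>2 + c\<^sup>2)"
proof -
  have "3 * (a\<^sup>2 + b\<^sup>2 + c\<^sup>2) - (a + b + c)\<^sup>2 = (a - b)\<^sup>2 + (a - c)\<^sup>2 + (b - c)\<^sup>2"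
    by (simp add: power2_eq_square algebra_simps)
  then show ?thesis by (smt (verit) zero_le_power2)
qed

text \<open>
  The recursions that link the consensus errors of two consecutive iterations.  All coupling
  constants are so small that the plain sum of squares serves as a Lyapunov function: its decrease
  and the two good terms of the accelerated step, those with \<open>G\<close> and \<open>D\<close> on the right, together
  cover the last two terms on the left, which are the errors that enter the potential.
\<close>
lemma consensus_errors_absorbed:
  fixes z y s r :: real
  assumes nonneg: "0 \<le> s'" "0 \<le> z'" "0 \<le> y'" "0 \<le> r'"
    and s': "s' \<le> 12 / 1000 * (s + G + r)"
    and z': "z' \<le> (z + s') / 100"
    and y': "y' \<le> 12 / 1000 * (z' + y)"
    and r': "r' \<le> 6 / 1000 * (z + y + D)"
  shows "z'\<^sup>2 + y'\<^sup>2 + s'\<^sup>2 + r'\<^sup>2 + (z + s')\<^sup>2 / 4 + (z + y)\<^sup>2 / 400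
    \<le> z\<^sup>2 + y\<^sup>2 + s\<^sup>2 + r\<^sup>2 + 60 * G\<^sup>2 + 199 / 400 * D\<^sup>2"
proof -
  have small: "(12 / 1000)\<^sup>2 * (3 * (a\<^sup>2 + b\<^sup>2 + c\<^sup>2)) \<le> (a\<^sup>2 + b\<^sup>2 + c\<^sup>2) / 1000" for a b c :: real
  proof -
    have "0 \<le> a\<^sup>2 + b\<^sup>2 + c\<^sup>2" by simp
    then show ?thesis unfolding power2_eq_square[of "12 / 1000"] by argo
  qed
  have "s'\<^sup>2 \<le> (12 / 1000 * (s + G + r))\<^sup>2"
    using s' nonneg by (intro power_mono) auto
  also have "\<dots> \<le> (12 / 1000)\<^sup>2 * (3 * (s\<^sup>2 + G\<^sup>2 + r\<^sup>2))"
    unfolding power_mult_distrib by (intro mult_left_mono square_sum3_le) simp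
  also have "\<dots> \<le> (s\<^sup>2 + G\<^sup>2 + r\<^sup>2) / 1000" by (rule small)
  finally have s2: "s'\<^sup>2 \<le> (s\<^sup>2 + G\<^sup>2 + r\<^sup>2) / 1000" .
  have zs: "(z + s')\<^sup>2 \<le> 2 * z\<^sup>2 + 2 * s'\<^sup>2" and zy: "(z + y)\<^sup>2 \<le> 2 * z\<^sup>2 + 2 * y\<^sup>2"
    using zero_le_power2[of "z - s'"] zero_le_power2[of "z - y"]
    by (simp_all add: power2_eq_square algebra_simps)
  have "z'\<^sup>2 \<le> ((z + s') / 100)\<^sup>2" using z' nonneg by (intro power_mono) auto
  then have z2: "z'\<^sup>2 \<le> (z\<^sup>2 + s'\<^sup>2) / 5000" using zs by (simp add: power_divide)
  have "y'\<^sup>2 \<le> (12 / 1000 * (z' + y))\<^sup>2" using y' nonneg by (intro power_mono) auto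
  also have "\<dots> \<le> (12 / 1000)\<^sup>2 * (3 * (z'\<^sup>2 + y\<^sup>2 + 0\<^sup>2))"
    unfolding power_mult_distrib using square_sum3_le[of z' y 0] by (intro mult_left_mono) auto
  also have "\<dots> \<le> (z'\<^sup>2 + y\<^sup>2 + 0\<^sup>2) / 1000" by (rule small)
  finally have y2: "y'\<^sup>2 \<le> (z'\<^sup>2 + y\<^sup>2) / 1000" by simp
  have "r'\<^sup>2 \<le> (6 / 1000 * (z + y + D))\<^sup>2" using r' nonneg by (intro power_mono) auto
  also have "\<dots> \<le> (6 / 1000)\<^sup>2 * (3 * (z\<^sup>2 + y\<^sup>2 + D\<^sup>2))"
    unfolding power_mult_distrib by (intro mult_left_mono square_sum3_le) simp
  also have "\<dots> \<le> (12 / 1000)\<^sup>2 * (3 * (z\<^sup>2 + y\<^sup>2 + D\<^sup>2))"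
    by (intro mult_right_mono power_mono) auto
  also have "\<dots> \<le> (z\<^sup>2 + y\<^sup>2 + D\<^sup>2) / 1000" by (rule small)
  finally have r2: "r'\<^sup>2 \<le> (z\<^sup>2 + y\<^sup>2 + D\<^sup>2) / 1000" .
  have pos: "0 \<le> z\<^sup>2" "0 \<le> y\<^sup>2" "0 \<le> s\<^sup>2" "0 \<le> r\<^sup>2" "0 \<le> G\<^sup>2" "0 \<le> D\<^sup>2" by simp_all
  show ?thesis using s2 zs zy z2 y2 r2 pos by argo
qed

text \<open>
  A run of the algorithm for a fixed \<open>W\<close>.  The network enters only through the two properties of
  \<open>FastMix\<close> below, which is why the final bound is uniform in \<open>W\<close>.
\<close>
locale odapg_run =
  fixes f :: "'m::finite \<Rightarrow> real^'d \<Rightarrow> real" and g :: "real^'d \<Rightarrow> real"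
    and L :: real and W :: "real^'m^'m" and K :: nat and x1 :: "real^'d"
  assumes smooth: "\<And>i. convex_smooth L (f i)" and convex: "convex_on UNIV g" and L_pos: "L > 0"
    and mix: "\<And>X :: real^'d^'m. norm (deviation (FastMix W K X)) \<le> norm (deviation X) / 100"
    and row_average_mix: "\<And>X :: real^'d^'m. row_average (FastMix W K X) = row_average X"
begin

definition \<gamma> :: "nat \<Rightarrow> real" where "\<gamma> t = (real t + 4) / (400 * L)"
definition \<tau> :: "nat \<Rightarrow> real" where "\<tau> t = 2 / (real t + 4)"

definition state where "state t = odapg f g W K \<gamma> \<tau> x1 t"
abbreviation "x t \<equiv> st_x (state t)"
abbreviation "y t \<equiv> st_y (state t)"
abbreviation "z t \<equiv> st_z (state t)"
abbreviation "s t \<equiv> st_s (state t)"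
abbreviation "ybar t \<equiv> row_average (y t)"
abbreviation "zbar t \<equiv> row_average (z t)"

lemma state_Suc:
  assumes "1 \<le> t"
  shows "state (Suc t) = odapg_step f g W K (\<gamma> t) (\<tau> t) (state t)"
  using assms by (cases t) (simp_all add: state_def)

lemma iterates:
  assumes "1 \<le> t"
  shows "x (Suc t) = \<tau> t *\<^sub>R z t + (1 - \<tau> t) *\<^sub>R y t"
    and "s (Suc t) = FastMix W K (s t + local_gradients f (x (Suc t)) - local_gradients f (x t))"
    and "z (Suc t) = FastMix W K (row_prox (\<gamma> t) g (z t - \<gamma> t *\<^sub>R s (Suc t)))"
    and "y (Suc t) = FastMix W K (\<tau> t *\<^sub>R z (Suc t) + (1 - \<tau> t) *\<^sub>R y t)"
  by (simp_all add: state_Suc[OF assms] odapg_step_def Let_def)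

lemma initial_iterates:
  "x (Suc 0) = consensus x1" "y (Suc 0) = consensus x1" "z (Suc 0) = consensus x1"
  "s (Suc 0) = local_gradients f (consensus x1)"
  by (simp_all add: state_def odapg_init_def Let_def consensus_def)

text \<open>
  Mixing preserves averages, so the update of \<open>s\<close> telescopes.
\<close>
lemma gradient_tracking:
  assumes "1 \<le> t"
  shows "row_average (s t) = row_average (local_gradients f (x t))"
  using assms
proof (induction t rule: dec_induct)
  case (step t)
  then show ?case unfolding iterates(2)[OF step(1)] row_average_mix by simp
qed (simp add: initial_iterates)

lemma parameters:
  assumes "1 \<le> t"
  shows "0 < \<gamma> t" "0 < \<tau> t" "\<tau> t \<le> 2 / 5" "\<gamma> t \<le> \<gamma> (Suc t)" "\<gamma> (Suc t) \<le> 6 / 5 * \<gamma> t"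
    "\<tau> t \<le> 6 / 5 * \<tau> (Suc t)" "200 * L * \<gamma> t * \<tau> t = 1"
proof -
  have "(real t + 4) / (real t + 4) = 1" by simp
  then show "200 * L * \<gamma> t * \<tau> t = 1" using L_pos by (simp add: \<gamma>_def \<tau>_def)
qed (use assms L_pos in \<open>simp_all add: \<gamma>_def \<tau>_def field_simps\<close>)

text \<open>
  The consensus errors, scaled such that their recursions have bounded coefficients although the
  step size \<open>\<gamma>\<close> grows linearly: \<open>y\<close> deviates by order \<open>\<tau>\<close> times the deviation of \<open>z\<close>, and gradients
  enter the update of \<open>z\<close> multiplied by \<open>\<gamma>\<close>.  The error \<open>err_x\<close> bounds the effect of the distance
  between the rows of \<open>x\<close> and the average of \<open>y\<close> on the gradients.
\<close>
definition err_z where "err_z t = norm (deviation (z t))"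
definition err_y where "err_y t = norm (deviation (y t)) / \<tau> t"
definition err_s where "err_s t = \<gamma> t * norm (deviation (s t))"
definition err_x where "err_x t = L * \<gamma> t * norm (x t - consensus (ybar t))"
definition grad_gap where
  "grad_gap t = \<gamma> t * norm (local_gradients f (consensus (ybar t)) - local_gradients f (x (Suc t)))"
definition z_move where "z_move t = sqrt (real CARD('m)) * norm (zbar (Suc t) - zbar t)"

text \<open>
  The change of the gradients from \<open>x t\<close> to \<open>x (Suc t)\<close> is split at the average of \<open>y t\<close>: the second
  part is the gap that the accelerated step controls, the first is controlled by \<open>err_x\<close>.
\<close>
lemma err_s_Suc:
  assumes t: "1 \<le> t"
  shows "err_s (Suc t) \<le> 12 / 1000 * (err_s t + grad_gap t + err_x t)"
proof -
  note p = parameters[OF t]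
  define u where "u = local_gradients f (consensus (ybar t))"
  have "norm (deviation (local_gradients f (x (Suc t)) - local_gradients f (x t)))
      \<le> norm ((local_gradients f (x (Suc t)) - u) - (local_gradients f (x t) - u))"
    using norm_deviation_le[of "local_gradients f (x (Suc t)) - local_gradients f (x t)" 0]
    by (simp add: consensus_def zero_vec_def[symmetric])
  also have "\<dots> \<le> norm (local_gradients f (x (Suc t)) - u) + norm (local_gradients f (x t) - u)"
    by (rule norm_triangle_ineq4)
  also have "norm (local_gradients f (x t) - u) \<le> L * norm (x t - consensus (ybar t))"
    unfolding u_def by (rule local_gradients_lipschitz[OF smooth L_pos])
  finally have d: "norm (deviation (local_gradients f (x (Suc t)) - local_gradients f (x t)))
      \<le> norm (u - local_gradients f (x (Suc t))) + L * norm (x t - consensus (ybar t))"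
    by (simp add: norm_minus_commute)
  have "norm (deviation (s (Suc t)))
      \<le> norm (deviation (s t + (local_gradients f (x (Suc t)) - local_gradients f (x t)))) / 100"
    unfolding iterates(2)[OF t] using mix by (metis add_diff_eq)
  also have "\<dots> \<le> (norm (deviation (s t)) + norm (u - local_gradients f (x (Suc t)))
      + L * norm (x t - consensus (ybar t))) / 100"
    unfolding deviation_simps(1)[of "s t"]
    using norm_triangle_ineq[of "deviation (s t)"
        "deviation (local_gradients f (x (Suc t)) - local_gradients f (x t))"] d by simp
  finally have "err_s (Suc t) \<le> (6 / 5 * \<gamma> t) * ((norm (deviation (s t))
      + norm (u - local_gradients f (x (Suc t))) + L * norm (x t - consensus (ybar t))) / 100)"
    unfolding err_s_def using p by (intro mult_mono) auto
  then show ?thesis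
    unfolding err_s_def grad_gap_def err_x_def u_def by (simp add: algebra_simps)
qed

lemma prox_argument_deviation:
  assumes t: "1 \<le> t"
  shows "norm (deviation (z t - \<gamma> t *\<^sub>R s (Suc t))) \<le> err_z t + err_s (Suc t)"
proof -
  note p = parameters[OF t]
  have "norm (deviation (z t - \<gamma> t *\<^sub>R s (Suc t))) \<le> err_z t + \<gamma> t * norm (deviation (s (Suc t)))"
    unfolding deviation_simps err_z_def using norm_triangle_ineq4[of "deviation (z t)"] p(1)
    by (metis abs_of_pos norm_scaleR)
  also have "\<gamma> t * norm (deviation (s (Suc t))) \<le> err_s (Suc t)"
    unfolding err_s_def using p by (intro mult_right_mono) auto
  finally show ?thesis by simp
qed

lemma err_z_Suc:
  assumes t: "1 \<le> t"
  shows "err_z (Suc t) \<le> (err_z t + err_s (Suc t)) / 100"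
proof -
  have "err_z (Suc t) \<le> norm (deviation (row_prox (\<gamma> t) g (z t - \<gamma> t *\<^sub>R s (Suc t)))) / 100"
    unfolding err_z_def iterates(3)[OF t] by (rule mix)
  also have "\<dots> \<le> (err_z t + err_s (Suc t)) / 100"
    using deviation_row_prox_le[OF convex parameters(1)[OF t]] prox_argument_deviation[OF t]
    by (meson divide_right_mono order_trans zero_le_numeral)
  finally show ?thesis .
qed

lemma interpolation_deviation:
  assumes t: "1 \<le> t"
  shows "norm (deviation (\<tau> t *\<^sub>R Z + (1 - \<tau> t) *\<^sub>R y t)) \<le> \<tau> t * (norm (deviation Z) + err_y t)"
proof -
  note p = parameters[OF t]
  have "norm (deviation (\<tau> t *\<^sub>R Z + (1 - \<tau> t) *\<^sub>R y t))
      \<le> \<tau> t * norm (deviation Z) + (1 - \<tau> t) * norm (deviation (y t))"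
    unfolding deviation_simps
    using norm_triangle_ineq[of "\<tau> t *\<^sub>R deviation Z" "(1 - \<tau> t) *\<^sub>R deviation (y t)"] p by simp
  also have "(1 - \<tau> t) * norm (deviation (y t)) \<le> 1 * norm (deviation (y t))"
    using p by (intro mult_right_mono) auto
  finally show ?thesis unfolding err_y_def using p by (simp add: distrib_left)
qed

lemma err_y_Suc:
  assumes t: "1 \<le> t"
  shows "err_y (Suc t) \<le> 12 / 1000 * (err_z (Suc t) + err_y t)"
proof -
  note p = parameters[OF t]
  have \<tau>': "\<tau> (Suc t) > 0" by (simp add: \<tau>_def)
  have nn: "0 \<le> err_z (Suc t) + err_y t" unfolding err_z_def err_y_def using p by simp
  have "norm (deviation (y (Suc t))) \<le> \<tau> t * (err_z (Suc t) + err_y t) / 100"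
    unfolding iterates(4)[OF t] err_z_def
    by (rule order_trans[OF mix]) (simp add: interpolation_deviation[OF t])
  also have "\<dots> \<le> (6 / 5 * \<tau> (Suc t)) * (err_z (Suc t) + err_y t) / 100"
    using p nn by (intro divide_right_mono mult_right_mono) auto
  finally show ?thesis
    unfolding err_y_def[of "Suc t"] using \<tau>' by (simp add: field_simps)
qed

lemma averages_Suc:
  assumes t: "1 \<le> t"
  shows "row_average (x (Suc t)) = \<tau> t *\<^sub>R zbar t + (1 - \<tau> t) *\<^sub>R ybar t"
    and "zbar (Suc t) = row_average (row_prox (\<gamma> t) g (z t - \<gamma> t *\<^sub>R s (Suc t)))"
    and "ybar (Suc t) = \<tau> t *\<^sub>R zbar (Suc t) + (1 - \<tau> t) *\<^sub>R ybar t"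
  by (simp_all only: iterates(1,3,4)[OF t] row_average_mix row_average_simps)

lemma x_deviation:
  assumes t: "1 \<le> t"
  shows "norm (deviation (x (Suc t))) \<le> \<tau> t * (err_z t + err_y t)"
  unfolding iterates(1)[OF t] err_z_def by (rule interpolation_deviation[OF t])

text \<open>
  The average of \<open>x (Suc t)\<close> differs from that of \<open>y (Suc t)\<close> by \<open>\<tau>\<close> times the move of the average of
  \<open>z\<close>, and \<open>200 * L * \<gamma> * \<tau> = 1\<close>.
\<close>
lemma err_x_Suc:
  assumes t: "1 \<le> t"
  shows "err_x (Suc t) \<le> 6 / 1000 * (err_z t + err_y t + z_move t)"
proof -
  note p = parameters[OF t]
  have "row_average (x (Suc t)) - ybar (Suc t) = \<tau> t *\<^sub>R (zbar t - zbar (Suc t))"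
    unfolding averages_Suc(1,3)[OF t] by (simp add: algebra_simps)
  then have "norm (row_average (x (Suc t)) - ybar (Suc t)) = \<tau> t * norm (zbar (Suc t) - zbar t)"
    using p by (simp add: norm_minus_commute)
  then have "norm (x (Suc t) - consensus (ybar (Suc t))) \<le> \<tau> t * (err_z t + err_y t + z_move t)"
    using norm_diff_consensus_le[of "x (Suc t)" "ybar (Suc t)"] x_deviation[OF t]
    unfolding z_move_def by (simp add: algebra_simps)
  then have "err_x (Suc t) \<le> L * (6 / 5 * \<gamma> t) * (\<tau> t * (err_z t + err_y t + z_move t))"
    unfolding err_x_def using p L_pos by (intro mult_mono mult_left_mono) auto
  also have "\<dots> = 6 / 1000 * (200 * L * \<gamma> t * \<tau> t) * (err_z t + err_y t + z_move t)" by simp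
  finally show ?thesis unfolding p(7) by simp
qed

text \<open>
  The weight of the suboptimality is \<open>(1 - \<tau> t) * \<gamma> t / \<tau> t\<close>, so that multiplying
  \<open>accelerated_step\<close> by \<open>\<gamma> t / \<tau> t\<close> turns its right-hand side into the potential.
\<close>
definition potential where
  "potential w t = real CARD('m) * ((real t + 2) * (real t + 4) / (800 * L))
       * (objective f g (ybar t) - objective f g w)
     + real CARD('m) / 2 * (norm (zbar t - w))\<^sup>2"

text \<open>
  The accelerated step, multiplied by \<open>\<kappa> = \<gamma> t / \<tau> t\<close>.  It telescopes because the weight of the
  next suboptimality is at most \<open>\<kappa>\<close>, that is \<open>(t + 3) * (t + 5) \<le> (t + 4)\<^sup>2\<close>; the coefficients 60 and
  199 / 400 come from \<open>1 - \<tau> t \<ge> 3 / 5\<close> and \<open>L * \<kappa> * (\<tau> t)\<^sup>2 = 1 / 200\<close>.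
\<close>
lemma potential_Suc:
  assumes t: "1 \<le> t" and w: "\<And>v. objective f g w \<le> objective f g v"
  shows "potential w (Suc t) \<le> potential w t - 60 * (grad_gap t)\<^sup>2 - 199 / 400 * (z_move t)\<^sup>2
    + (err_z t + err_s (Suc t))\<^sup>2 / 4 + (err_z t + err_y t)\<^sup>2 / 400"
proof -
  note p = parameters[OF t]
  define m where "m = real CARD('m)"
  define \<kappa> where "\<kappa> = \<gamma> t / \<tau> t"
  define h where "h t = objective f g (ybar t) - objective f g w" for t
  define V where "V = norm (deviation (z t - \<gamma> t *\<^sub>R s (Suc t)))"
  define G where "G = norm (local_gradients f (consensus (ybar t)) - local_gradients f (x (Suc t)))"
  define D where "D = (norm (zbar (Suc t) - zbar t))\<^sup>2"
  define X where "X = norm (deviation (x (Suc t)))"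
  have \<kappa>: "\<kappa> > 0" "\<kappa> * (\<tau> t / \<gamma> t) = 1" unfolding \<kappa>_def using p by simp_all
  have h: "h t \<ge> 0" for t unfolding h_def using w by simp
  have "m * h (Suc t) + \<tau> t / \<gamma> t * (m / 2 * (norm (zbar (Suc t) - w))\<^sup>2)
      \<le> (1 - \<tau> t) * (m * h t) + \<tau> t / \<gamma> t * (m / 2 * (norm (zbar t - w))\<^sup>2)
        - (1 - \<tau> t) * G\<^sup>2 / (2 * L) - (\<tau> t / \<gamma> t - L * (\<tau> t)\<^sup>2) * (m / 2 * D)
        + \<tau> t / \<gamma> t * (V\<^sup>2 / 4) + L / 2 * X\<^sup>2"
    unfolding h_def m_def V_def G_def D_def X_def averages_Suc(3)[OF t] averages_Suc(2)[OF t]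
    using p gradient_tracking[of "Suc t"] averages_Suc(1)[OF t]
    by (intro accelerated_step[OF smooth convex L_pos]) auto
  then have "\<kappa> * (m * h (Suc t) + \<tau> t / \<gamma> t * (m / 2 * (norm (zbar (Suc t) - w))\<^sup>2))
      \<le> \<kappa> * ((1 - \<tau> t) * (m * h t) + \<tau> t / \<gamma> t * (m / 2 * (norm (zbar t - w))\<^sup>2)
        - (1 - \<tau> t) * G\<^sup>2 / (2 * L) - (\<tau> t / \<gamma> t - L * (\<tau> t)\<^sup>2) * (m / 2 * D)
        + \<tau> t / \<gamma> t * (V\<^sup>2 / 4) + L / 2 * X\<^sup>2)"
    using \<kappa> by (intro mult_left_mono) auto
  moreover have "\<kappa> * (m * h (Suc t) + \<tau> t / \<gamma> t * (m / 2 * (norm (zbar (Suc t) - w))\<^sup>2))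
      = \<kappa> * m * h (Suc t) + (\<kappa> * (\<tau> t / \<gamma> t)) * (m / 2 * (norm (zbar (Suc t) - w))\<^sup>2)"
    by (simp add: distrib_left)
  moreover have "\<kappa> * ((1 - \<tau> t) * (m * h t) + \<tau> t / \<gamma> t * (m / 2 * (norm (zbar t - w))\<^sup>2)
        - (1 - \<tau> t) * G\<^sup>2 / (2 * L) - (\<tau> t / \<gamma> t - L * (\<tau> t)\<^sup>2) * (m / 2 * D)
        + \<tau> t / \<gamma> t * (V\<^sup>2 / 4) + L / 2 * X\<^sup>2)
      = \<kappa> * (1 - \<tau> t) * m * h t + (\<kappa> * (\<tau> t / \<gamma> t)) * (m / 2 * (norm (zbar t - w))\<^sup>2)
        - \<kappa> * ((1 - \<tau> t) * G\<^sup>2 / (2 * L)) - (\<kappa> * (\<tau> t / \<gamma> t) - L * (\<kappa> * (\<tau> t)\<^sup>2)) * (m / 2 * D)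
        + (\<kappa> * (\<tau> t / \<gamma> t)) * (V\<^sup>2 / 4) + L / 2 * (\<kappa> * X\<^sup>2)"
    by (simp only: distrib_left right_diff_distrib left_diff_distrib mult_ac)
  ultimately have step: "\<kappa> * m * h (Suc t) + m / 2 * (norm (zbar (Suc t) - w))\<^sup>2
      \<le> \<kappa> * (1 - \<tau> t) * m * h t + m / 2 * (norm (zbar t - w))\<^sup>2
        - \<kappa> * ((1 - \<tau> t) * G\<^sup>2 / (2 * L)) - (1 - L * (\<kappa> * (\<tau> t)\<^sup>2)) * (m / 2 * D)
        + V\<^sup>2 / 4 + L / 2 * (\<kappa> * X\<^sup>2)"
    unfolding \<kappa>(2) by simp
  have \<kappa>_eq: "\<kappa> = (real t + 4)\<^sup>2 / (800 * L)"
    unfolding \<kappa>_def \<gamma>_def \<tau>_def by (simp add: power2_eq_square)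
  have \<kappa>\<tau>: "\<kappa> * (\<tau> t)\<^sup>2 = 1 / (200 * L)"
    unfolding \<kappa>_eq \<tau>_def by (simp add: power_divide)
  have "(real t + 3) * (real t + 5) / (800 * L) \<le> \<kappa>"
    unfolding \<kappa>_eq using L_pos
    by (intro divide_right_mono) (simp_all add: power2_eq_square algebra_simps)
  then have next_weight: "m * ((real (Suc t) + 2) * (real (Suc t) + 4) / (800 * L)) * h (Suc t) \<le> \<kappa> * m * h (Suc t)"
    using h[of "Suc t"] unfolding mult.commute[of \<kappa>]
    by (intro mult_right_mono mult_left_mono) (simp_all add: m_def add_ac)
  have this_weight: "\<kappa> * (1 - \<tau> t) = (real t + 2) * (real t + 4) / (800 * L)"
  proof -
    have "1 - \<tau> t = (real t + 2) / (real t + 4)" unfolding \<tau>_def by (simp add: field_simps)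
    then show ?thesis unfolding \<kappa>_eq by (simp add: power2_eq_square)
  qed
  have "\<kappa> = 200 * L * (\<gamma> t)\<^sup>2"
    unfolding \<kappa>_def using p by (simp add: field_simps power2_eq_square)
  then have "\<kappa> * ((1 - \<tau> t) * G\<^sup>2 / (2 * L)) = 100 * (1 - \<tau> t) * (\<gamma> t * G)\<^sup>2"
    using L_pos by (simp add: power_mult_distrib)
  also have "\<dots> \<ge> 60 * (\<gamma> t * G)\<^sup>2"
    using p by (intro mult_right_mono) auto
  finally have gap: "60 * (grad_gap t)\<^sup>2 \<le> \<kappa> * ((1 - \<tau> t) * G\<^sup>2 / (2 * L))"
    unfolding grad_gap_def G_def .
  have move: "(1 - L * (\<kappa> * (\<tau> t)\<^sup>2)) * (m / 2 * D) = 199 / 400 * (z_move t)\<^sup>2"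
    unfolding \<kappa>\<tau> z_move_def D_def m_def using L_pos by (simp add: power_mult_distrib)
  have "V\<^sup>2 \<le> (err_z t + err_s (Suc t))\<^sup>2"
    unfolding V_def by (intro power_mono prox_argument_deviation[OF t]) simp
  moreover have "L / 2 * (\<kappa> * X\<^sup>2) \<le> (err_z t + err_y t)\<^sup>2 / 400"
  proof -
    have "X\<^sup>2 \<le> (\<tau> t * (err_z t + err_y t))\<^sup>2"
      unfolding X_def by (intro power_mono x_deviation[OF t]) simp
    then have "L / 2 * (\<kappa> * X\<^sup>2) \<le> L / 2 * (\<kappa> * (\<tau> t * (err_z t + err_y t))\<^sup>2)"
      using L_pos \<kappa> by (intro mult_left_mono) auto
    also have "\<dots> = L / 2 * ((\<kappa> * (\<tau> t)\<^sup>2) * (err_z t + err_y t)\<^sup>2)" by (simp add: power_mult_distrib)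
    finally show ?thesis unfolding \<kappa>\<tau> using L_pos by simp
  qed
  ultimately show ?thesis
    using step next_weight gap unfolding move potential_def this_weight m_def[symmetric] h_def[symmetric]
    by (simp add: mult.commute mult.left_commute)
qed

definition lyapunov where
  "lyapunov w t = potential w t + (err_z t)\<^sup>2 + (err_y t)\<^sup>2 + (err_s t)\<^sup>2 + (err_x t)\<^sup>2"

lemma lyapunov_decreasing:
  assumes t: "1 \<le> t" and w: "\<And>v. objective f g w \<le> objective f g v"
  shows "lyapunov w (Suc t) \<le> lyapunov w t"
proof -
  have "0 < \<tau> t" "0 < \<gamma> t" for t using L_pos by (simp_all add: \<tau>_def \<gamma>_def)
  then have "0 \<le> err_z t" "0 \<le> err_y t" "0 \<le> err_s t" "0 \<le> err_x t" for t
    using L_pos by (simp_all add: err_z_def err_y_def err_s_def err_x_def less_imp_le)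
  then show ?thesis
    using consensus_errors_absorbed[OF _ _ _ _
        err_s_Suc[OF t] err_z_Suc[OF t] err_y_Suc[OF t] err_x_Suc[OF t]]
      potential_Suc[OF t w] unfolding lyapunov_def by (smt (verit))
qed

text \<open>
  All rows agree initially, so the only consensus error in the initial Lyapunov value is that of
  the local gradients at \<open>x1\<close>, of weight \<open>\<gamma> 1 = 5 / (400 * L)\<close>.
\<close>
theorem suboptimality_bound:
  assumes t: "1 \<le> t" and w: "\<And>v. objective f g w \<le> objective f g v"
  shows "objective f g (ybar t) - objective f g w
    \<le> 800 * L * (real CARD('m) * (15 / (800 * L)) * (objective f g x1 - objective f g w)
        + real CARD('m) / 2 * (norm (x1 - w))\<^sup>2
        + (5 / (400 * L) * norm (deviation (local_gradients f (consensus x1) :: real^'d^'m)))\<^sup>2) / (real t)\<^sup>2"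
    (is "?h \<le> 800 * L * ?C / _")
proof -
  define C where "C = ?C"
  have h: "?h \<ge> 0" using w by simp
  have "lyapunov w t \<le> lyapunov w 1"
    using t by (induction t rule: dec_induct) (auto intro: order_trans[OF lyapunov_decreasing[OF _ w]])
  also have "\<dots> = ?C"
    by (simp add: lyapunov_def potential_def initial_iterates err_z_def err_y_def err_s_def err_x_def
        deviation_simps \<gamma>_def)
  finally have "lyapunov w t \<le> C" unfolding C_def .
  moreover have "((real t)\<^sup>2 / (800 * L)) * ?h \<le> lyapunov w t"
  proof -
    have "(real t)\<^sup>2 \<le> (real t + 2) * (real t + 4)" by (simp add: power2_eq_square algebra_simps)
    also have "\<dots> = 1 * ((real t + 2) * (real t + 4))" by simp
    also have "\<dots> \<le> real CARD('m) * ((real t + 2) * (real t + 4))"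
      by (intro mult_right_mono) (simp_all add: Suc_leI)
    finally have "(real t)\<^sup>2 / (800 * L) \<le> real CARD('m) * ((real t + 2) * (real t + 4) / (800 * L))"
      using L_pos by (simp add: divide_right_mono)
    then have "(real t)\<^sup>2 / (800 * L) * ?h \<le> real CARD('m) * ((real t + 2) * (real t + 4) / (800 * L)) * ?h"
      using h by (rule mult_right_mono)
    then show ?thesis unfolding lyapunov_def potential_def
      by (smt (verit) zero_le_power2 mult_nonneg_nonneg of_nat_0_le_iff divide_nonneg_nonneg)
  qed
  ultimately have "(real t)\<^sup>2 / (800 * L) * ?h \<le> C" by simp
  then have "?h \<le> 800 * L * C / (real t)\<^sup>2" using t L_pos by (simp add: field_simps)
  then show ?thesis unfolding C_def .
qed

end

section \<open>Complexity\<close>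

text \<open>
  Rounding up costs at most \<open>1 \<le> 1 / sqrt (1 - \<mu>)\<close>.
\<close>
lemma rounds_bound:
  assumes "0 \<le> \<mu>" "\<mu> < (1::real)"
  shows "real (nat \<lceil>15 / sqrt (1 - \<mu>)\<rceil>) \<le> 16 / sqrt (1 - \<mu>)"
proof -
  define q where "q = sqrt (1 - \<mu>)"
  have q: "0 < q" "q \<le> 1" using assms unfolding q_def by auto
  then have "1 \<le> 1 / q" and "0 \<le> 15 / q" by simp_all
  then show ?thesis unfolding q_def[symmetric] by linarith
qed

lemma first_suboptimal_index_bound:
  assumes C: "C \<ge> 0" and \<epsilon>: "0 < \<epsilon>"
    and rate: "\<And>t. 1 \<le> t \<Longrightarrow> F (u t) - F xstar \<le> C / (real t)\<^sup>2"
  shows "\<exists>T \<ge> 1. eps_suboptimal F xstar \<epsilon> (u T)"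
    and "\<epsilon> < 1 \<Longrightarrow> real (computation_complexity F xstar u \<epsilon>) \<le> (sqrt C + 2) / sqrt \<epsilon>"
proof -
  \<comment> \<open>The summand \<open>1\<close> ensures \<open>T \<ge> 1\<close> when \<open>C = 0\<close>.\<close>
  define T where "T = nat \<lceil>sqrt (C / \<epsilon>)\<rceil> + 1"
  have T: "1 \<le> T" "sqrt (C / \<epsilon>) \<le> real T" "real T \<le> sqrt (C / \<epsilon>) + 2"
  proof -
    have "0 \<le> sqrt (C / \<epsilon>)" using C \<epsilon> by simp
    then show "1 \<le> T" "sqrt (C / \<epsilon>) \<le> real T" "real T \<le> sqrt (C / \<epsilon>) + 2"
      unfolding T_def by linarith+
  qed
  have "C / \<epsilon> = (sqrt (C / \<epsilon>))\<^sup>2" using C \<epsilon> by simp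
  also have "\<dots> \<le> (real T)\<^sup>2" using T(2) C \<epsilon> by (intro power_mono) auto
  finally have "C / (real T)\<^sup>2 \<le> \<epsilon>" using T(1) \<epsilon> by (simp add: field_simps)
  then have sub: "1 \<le> T \<and> eps_suboptimal F xstar \<epsilon> (u T)"
    using rate[OF T(1)] T(1) unfolding eps_suboptimal_def by simp
  then show "\<exists>T \<ge> 1. eps_suboptimal F xstar \<epsilon> (u T)" by blast
  assume "\<epsilon> < 1"
  then have "2 \<le> 2 / sqrt \<epsilon>" using \<epsilon> by (simp add: le_divide_eq)
  moreover have "computation_complexity F xstar u \<epsilon> \<le> T"
    unfolding computation_complexity_def using sub by (rule Least_le)
  ultimately show "real (computation_complexity F xstar u \<epsilon>) \<le> (sqrt C + 2) / sqrt \<epsilon>"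
    using T(3) by (simp add: real_sqrt_divide add_divide_distrib)
qed

theorem corollary4:
  fixes f :: "'m::finite \<Rightarrow> real^'d \<Rightarrow> real" and g :: "real^'d \<Rightarrow> real"
    and L c\<^sub>f :: real and x\<^sub>1 xstar :: "real^'d"
    and \<gamma> \<tau> :: "nat \<Rightarrow> real"
    and K :: "real^'m^'m \<Rightarrow> nat"
    and F :: "real^'d \<Rightarrow> real"
    and ybar :: "real^'m^'m \<Rightarrow> nat \<Rightarrow> real^'d"
  assumes "CARD('m) \<ge> 2" and "L > 0"
    and "\<forall>i. convex_smooth L (f i)"
    and "convex_on UNIV g"
    and "F = objective f g"
    and "\<forall>x. F xstar \<le> F x"
    and "c\<^sub>f = 200"
    and "\<gamma> = (\<lambda>t. (real t + 4) / (2 * L * c\<^sub>f))"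
    and "\<tau> = (\<lambda>t. 1 / (L * c\<^sub>f * \<gamma> t))"
    and "K = (\<lambda>W. nat \<lceil>15 / sqrt (1 - lambda2 W)\<rceil>)"
    and "ybar = (\<lambda>W t. row_average (st_y (odapg f g W (K W) \<gamma> \<tau> x\<^sub>1 t)))"
  shows
    "(\<forall>W \<in> admissible_weights. \<forall>\<epsilon> > 0. \<exists>T \<ge> 1. eps_suboptimal F xstar \<epsilon> (ybar W T)) \<and>
     (\<lambda>(\<epsilon>, W). real (computation_complexity F xstar (ybar W) \<epsilon>))
       \<in> O[at_right 0 \<times>\<^sub>F principal admissible_weights](\<lambda>(\<epsilon>, W). 1 / sqrt \<epsilon>) \<and>
     (\<lambda>(\<epsilon>, W). real (communication_complexity F xstar (ybar W) (K W) \<epsilon>))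
       \<in> O[at_right 0 \<times>\<^sub>F principal admissible_weights](\<lambda>(\<epsilon>, W). 1 / sqrt (\<epsilon> * (1 - lambda2 W)))"
proof -
  define C where "C = 800 * L * (real CARD('m) * (15 / (800 * L)) * (F x\<^sub>1 - F xstar)
      + real CARD('m) / 2 * (norm (x\<^sub>1 - xstar))\<^sup>2
      + (5 / (400 * L) * norm (deviation (local_gradients f (consensus x\<^sub>1) :: real^'d^'m)))\<^sup>2)"
  have C: "C \<ge> 0"
    unfolding C_def using \<open>L > 0\<close> assms(6)
    by (intro mult_nonneg_nonneg add_nonneg_nonneg) auto
  have rate: "F (ybar W t) - F xstar \<le> C / (real t)\<^sup>2" if W: "W \<in> admissible_weights" and t: "1 \<le> t" for W t
  proof -
    obtain E where E: "weight_matrix E W" using W by (auto simp: admissible_weights_def)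
    then have sym: "transpose W = W" and one: "W *v 1 = 1" by (simp_all add: weight_matrix_def)
    interpret run: odapg_run f g L W "K W" x\<^sub>1
      using assms(2,3,4) FastMix_contracts_deviation[OF E assms(1)] row_average_FastMix[OF sym one]
      by unfold_locales (simp_all add: assms(10))
    have \<gamma>_eq: "\<gamma> = run.\<gamma>" unfolding assms(7,8) run.\<gamma>_def by simp
    have "L * c\<^sub>f * \<gamma> t = (real t + 4) / 2" for t
      unfolding assms(7,8) using \<open>L > 0\<close> by simp
    then have "1 / (L * c\<^sub>f * \<gamma> t) = 2 / (real t + 4)" for t by (simp only: divide_divide_eq_right mult_1)
    then have "\<tau> = run.\<tau>" unfolding assms(9) run.\<tau>_def by blast
    with \<gamma>_eq have "ybar W t = row_average (st_y (run.state t))"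
      unfolding assms(11) run.state_def by simp
    then show ?thesis
      using run.suboptimality_bound[OF t, of xstar] assms(6) unfolding C_def assms(5) by simp
  qed
  have bound: "real (computation_complexity F xstar (ybar W) \<epsilon>) \<le> (sqrt C + 2) * (1 / sqrt \<epsilon>)"
    if "W \<in> admissible_weights" "0 < \<epsilon>" "\<epsilon> < 1" for W \<epsilon>
    using first_suboptimal_index_bound(2)[where F = F and u = "ybar W" and xstar = xstar,
        OF C that(2) rate[OF that(1)] that(3)] by simp
  have small: "\<forall>\<^sub>F (\<epsilon>, W) in at_right 0 \<times>\<^sub>F principal (admissible_weights :: (real^'m^'m) set).
      W \<in> admissible_weights \<and> 0 < \<epsilon> \<and> \<epsilon> < (1::real)"
  proof -
    have "\<forall>\<^sub>F \<epsilon> in at_right 0. \<epsilon> \<in> {0<..<1::real}"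
      by (rule eventually_at_right_real) simp
    moreover have "\<forall>\<^sub>F W in principal admissible_weights. W \<in> (admissible_weights :: (real^'m^'m) set)"
      by (simp add: eventually_principal)
    ultimately have "\<forall>\<^sub>F p in at_right 0 \<times>\<^sub>F principal admissible_weights.
        fst p \<in> {0<..<1::real} \<and> snd p \<in> (admissible_weights :: (real^'m^'m) set)"
      by (rule eventually_prodI)
    then show ?thesis by (rule eventually_mono) auto
  qed
  show ?thesis
  proof (intro conjI ballI allI impI)
    fix W :: "real^'m^'m" and \<epsilon> :: real assume "W \<in> admissible_weights" "\<epsilon> > 0"
    then show "\<exists>T \<ge> 1. eps_suboptimal F xstar \<epsilon> (ybar W T)"
      using first_suboptimal_index_bound(1)[where F = F and u = "ybar W" and xstar = xstar, OF C _ rate]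
      by blast
  next
    show "(\<lambda>(\<epsilon>, W). real (computation_complexity F xstar (ybar W) \<epsilon>))
       \<in> O[at_right 0 \<times>\<^sub>F principal admissible_weights](\<lambda>(\<epsilon>, W). 1 / sqrt \<epsilon>)"
      by (rule bigoI[where c = "sqrt C + 2"], rule eventually_mono[OF small]) (use bound in auto)
  next
    have "real (communication_complexity F xstar (ybar W) (K W) \<epsilon>)
        \<le> (48 * (sqrt C + 2)) * (1 / sqrt (\<epsilon> * (1 - lambda2 W)))"
      and "lambda2 W < 1"
      if W: "W \<in> admissible_weights" and \<epsilon>: "0 < \<epsilon>" "\<epsilon> < 1" for W \<epsilon>
    proof -
      obtain E where E: "weight_matrix E W" using W by (auto simp: admissible_weights_def)
      note spec = weight_matrix_spectrum(1,2)[OF E assms(1)]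
      show "lambda2 W < 1" by (rule spec)
      have "real (computation_complexity F xstar (ybar W) \<epsilon>) * real (K W)
          \<le> (sqrt C + 2) * (1 / sqrt \<epsilon>) * (16 / sqrt (1 - lambda2 W))"
        unfolding assms(10) using bound[OF W \<epsilon>] rounds_bound[OF spec] C \<epsilon>
        by (intro mult_mono) auto
      also have "\<dots> = 16 * ((sqrt C + 2) * (1 / sqrt (\<epsilon> * (1 - lambda2 W))))"
        by (simp add: real_sqrt_mult)
      finally show "real (communication_complexity F xstar (ybar W) (K W) \<epsilon>)
        \<le> (48 * (sqrt C + 2)) * (1 / sqrt (\<epsilon> * (1 - lambda2 W)))"
        unfolding communication_complexity_def of_nat_mult of_nat_numeral by linarith
    qed
    then show "(\<lambda>(\<epsilon>, W). real (communication_complexity F xstar (ybar W) (K W) \<epsilon>))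
       \<in> O[at_right 0 \<times>\<^sub>F principal admissible_weights](\<lambda>(\<epsilon>, W). 1 / sqrt (\<epsilon> * (1 - lambda2 W)))"
      by (intro bigoI[where c = "48 * (sqrt C + 2)"] eventually_mono[OF small]) fastforce
  qed
qed

end
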